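(* Let $\Omega\subset\mathbb{C}^n$ be a bounded domain and let $1<q<2<p<\infty$ with $\frac1p+\frac1q=1$. If the maps $\Phi_p:\mathcal{A}^q(\Omega)\to\mathcal{A}^p(\Omega)'$ and $\Phi_q:\mathcal{A}^p(\Omega)\to\mathcal{A}^q(\Omega)'$ are surjective, then for every $p'$ with $q\le p'\le p$ the map $\Phi_{p'}$ is surjective.
   Context: For a bounded domain $\Omega\subset\mathbb{C}^n$ and $1\le r<\infty$, $\mathcal{A}^r(\Omega)=\{f\in L^r(\Omega): f \text{ is holomorphic in }\Omega\}$ (Lebesgue measure), with the $L^r$ norm. $\mathcal{A}^r(\Omega)'$ denotes the Banach space dual. For conjugate exponents $r,s\in(1,\infty)$, $\frac1r+\frac1s=1$, the conjugate-linear map $\Phi_r:\mathcal{A}^s(\Omega)\to\mathcal{A}^r(\Omega)'$ is defined by $\Phi_r(g)(f)=\int_\Omega f\overline g\,dV$ for $g\in\mathcal{A}^s(\Omega)$, $f\in\mathcal{A}^r(\Omega)$. In the claim, $p'$ is just an exponent in $[q,p]$ (not the conjugate of $p$). *)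

theory Defs
  imports "HOL-Analysis.Analysis"
begin

text \<open>
  Holomorphy in several complex variables: complex Frechet differentiability, i.e. the real
  derivative exists and is complex-linear. Meant for open sets.
\<close>
definition holomorphic_several_on ::
    "(complex ^ 'n::finite \<Rightarrow> complex) \<Rightarrow> (complex ^ 'n) set \<Rightarrow> bool" where
  "holomorphic_several_on f \<Omega> \<longleftrightarrow>
     (\<forall>z\<in>\<Omega>. \<exists>D. (f has_derivative D) (at z) \<and> (\<forall>c v. D (c *s v) = c * D v))"

definition Lr_set :: "(complex ^ 'n::finite) set \<Rightarrow> real \<Rightarrow> (complex ^ 'n \<Rightarrow> complex) set" where
  "Lr_set \<Omega> r =
     {f. f \<in> borel_measurable (lebesgue_on \<Omega>) \<and>
         integrable (lebesgue_on \<Omega>) (\<lambda>z. norm (f z) powr r)}"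

definition Lr_norm :: "(complex ^ 'n::finite) set \<Rightarrow> real \<Rightarrow> (complex ^ 'n \<Rightarrow> complex) \<Rightarrow> real" where
  "Lr_norm \<Omega> r f = (\<integral>z. norm (f z) powr r \<partial>lebesgue_on \<Omega>) powr (1 / r)"

text \<open>
  Functions on \<open>\<Omega>\<close> are represented by their extension by zero, so that each element of the Bergman
  space has exactly one representative and the space is closed under the pointwise operations.
\<close>
definition bergman_space ::
    "(complex ^ 'n::finite) set \<Rightarrow> real \<Rightarrow> (complex ^ 'n \<Rightarrow> complex) set" where
  "bergman_space \<Omega> r =
     {f \<in> Lr_set \<Omega> r. holomorphic_several_on f \<Omega> \<and> (\<forall>z. z \<notin> \<Omega> \<longrightarrow> f z = 0)}"

text \<open>
  The bounded complex-linear functionals on the Bergman space. They are extensional (undefined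
  outside the space), so that equality of functionals is equality of HOL functions.
\<close>
definition bergman_dual ::
    "(complex ^ 'n::finite) set \<Rightarrow> real \<Rightarrow> ((complex ^ 'n \<Rightarrow> complex) \<Rightarrow> complex) set" where
  "bergman_dual \<Omega> r =
     {L \<in> extensional (bergman_space \<Omega> r).
        (\<forall>f\<in>bergman_space \<Omega> r. \<forall>g\<in>bergman_space \<Omega> r. L (\<lambda>z. f z + g z) = L f + L g) \<and>
        (\<forall>c. \<forall>f\<in>bergman_space \<Omega> r. L (\<lambda>z. c * f z) = c * L f) \<and>
        (\<exists>C. \<forall>f\<in>bergman_space \<Omega> r. norm (L f) \<le> C * Lr_norm \<Omega> r f)}"

definition bergman_Phi ::
    "(complex ^ 'n::finite) set \<Rightarrow> real \<Rightarrow> (complex ^ 'n \<Rightarrow> complex) \<Rightarrow>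
     (complex ^ 'n \<Rightarrow> complex) \<Rightarrow> complex" where
  "bergman_Phi \<Omega> r g =
     (\<lambda>f\<in>bergman_space \<Omega> r. \<integral>z. f z * cnj (g z) \<partial>lebesgue_on \<Omega>)"

end

theory Submission
  imports Defs
begin

text \<open>
  The proof interpolates the Bergman projection. Write \<open>A\<^sup>r\<close> for the Bergman space with exponent
  \<open>r\<close>; since \<open>\<Omega>\<close> is bounded, these spaces decrease as \<open>r\<close> grows. For \<open>u\<close> in \<open>L\<^sup>p\<close>, pairing with
  \<open>u\<close> is a bounded functional on \<open>A\<^sup>q\<close>, and surjectivity of \<open>\<Phi>\<^sub>q\<close> represents it by a function
  \<open>proj u\<close> in \<open>A\<^sup>p\<close>. This projection is symmetric (\<open>proj_symmetric\<close>), and additive almost everywhere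
  because an element of \<open>A\<^sup>p\<close> annihilated by \<open>A\<^sup>q\<close> is annihilated by itself (\<open>proj_add_AE\<close>).

  Symmetry bounds the pairings of \<open>proj v\<close>, for \<open>v\<close> in the unit ball of \<open>L\<^sup>q\<close>, with each single \<open>u\<close>
  in \<open>L\<^sup>p\<close>; the uniform boundedness principle (\<open>uniform_boundedness_Lspace\<close>) makes \<open>proj\<close> bounded
  in the \<open>L\<^sup>q\<close> norm, and symmetry again makes it bounded in the \<open>L\<^sup>p\<close> norm. Interpolation
  (\<open>Marcinkiewicz\<close>) gives boundedness in every intermediate norm.

  Given a bounded functional \<open>L\<close> on \<open>A\<^sup>r\<close> with \<open>q < r < p\<close> and conjugate exponent \<open>s\<close>, surjectivity of
  \<open>\<Phi>\<^sub>p\<close> represents its restriction to \<open>A\<^sup>p\<close> by some \<open>h\<close> in \<open>A\<^sup>q\<close>. For bounded \<open>u\<close> the pairing of \<open>u\<close>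
  with \<open>h\<close> equals \<open>L (proj u)\<close>, and is thus at most a constant times the \<open>L\<^sup>r\<close> norm of \<open>u\<close>. By the
  converse of Hoelder's inequality (\<open>converse_Holder\<close>), \<open>h\<close> lies in \<open>L\<^sup>s\<close>. Finally the projections of
  the truncations of an element \<open>g\<close> of \<open>A\<^sup>r\<close> lie in \<open>A\<^sup>p\<close> and converge to \<open>g\<close> in \<open>L\<^sup>r\<close>, so that \<open>h\<close>
  represents \<open>L\<close> on all of \<open>A\<^sup>r\<close> (\<open>pairing_onto_between\<close>). Estimating norms only through pairings with
  bounded functions replaces the extension of functionals to \<open>L\<^sup>r\<close> and the duality of the \<open>L\<^sup>r\<close> spaces.
\<close>

section \<open>Lebesgue spaces of complex functions\<close>

lemma conjugate_exponent:
  fixes r s :: real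
  assumes "1 < r" "1/r + 1/s = 1"
  shows "s = r / (r - 1)" "1 < s"
proof -
  have "s \<noteq> 0" using assms by auto
  then show s: "s = r / (r - 1)" using assms by (simp add: field_simps)
  show "1 < s" unfolding s using assms by simp
qed

lemma borel_measurable_cnj [measurable (raw)]:
  "f \<in> borel_measurable M \<Longrightarrow> (\<lambda>x. cnj (f x)) \<in> borel_measurable M"
  by (rule measurable_compose[OF _ borel_measurable_continuous_onI[of cnj]])
    (auto intro: continuous_intros)

lemma integral_pairing_cnj:
  fixes a b :: "'a \<Rightarrow> complex"
  shows "(\<integral>x. a x * cnj (b x) \<partial>M) = cnj (\<integral>x. b x * cnj (a x) \<partial>M)"
proof -
  have "(\<lambda>x. a x * cnj (b x)) = (\<lambda>x. cnj (b x * cnj (a x)))" by (simp add: mult.commute)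
  then show ?thesis by (simp only: Bochner_Integration.integral_cnj)
qed

text \<open>
  Members of this set are functions, not classes modulo null sets, so \<open>Lnorm\<close> below is only a
  seminorm on it.
\<close>
definition Lspace :: "'a measure \<Rightarrow> real \<Rightarrow> ('a \<Rightarrow> complex) set" where
  "Lspace M r = {f \<in> borel_measurable M. integrable M (\<lambda>x. norm (f x) powr r)}"

definition Lnorm :: "'a measure \<Rightarrow> real \<Rightarrow> ('a \<Rightarrow> complex) \<Rightarrow> real" where
  "Lnorm M r f = (\<integral>x. norm (f x) powr r \<partial>M) powr (1 / r)"

text \<open>
  The test functions of the duality arguments. On a finite measure space they belong to every
  \<open>Lspace M r\<close>, and every truncation of a measurable function is one of them.
\<close>
definition bdd_meas :: "'a measure \<Rightarrow> ('a \<Rightarrow> complex) set" where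
  "bdd_meas M = {u \<in> borel_measurable M. \<exists>B. \<forall>x. norm (u x) \<le> B}"

lemma Lspace_measurable [measurable_dest]: "f \<in> Lspace M r \<Longrightarrow> f \<in> borel_measurable M"
  by (simp add: Lspace_def)

lemma bdd_meas_measurable [measurable_dest]: "f \<in> bdd_meas M \<Longrightarrow> f \<in> borel_measurable M"
  by (simp add: bdd_meas_def)

lemma Lspace_integrable: "f \<in> Lspace M r \<Longrightarrow> integrable M (\<lambda>x. norm (f x) powr r)"
  by (simp add: Lspace_def)

lemma Lnorm_nonneg [simp]: "0 \<le> Lnorm M r f"
  by (simp add: Lnorm_def)

lemma Lnorm_powr: "0 < r \<Longrightarrow> Lnorm M r f powr r = (\<integral>x. norm (f x) powr r \<partial>M)"
  by (simp add: Lnorm_def powr_powr integral_nonneg_AE)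

lemma powr_add_le:
  fixes a b r :: real
  assumes "0 \<le> a" "0 \<le> b" "0 < r"
  shows "(a + b) powr r \<le> 2 powr r * (a powr r + b powr r)"
proof -
  have "(a + b) powr r \<le> (2 * max a b) powr r" using assms by (intro powr_mono2) auto
  also have "\<dots> = 2 powr r * max a b powr r" using assms by (simp add: powr_mult)
  also have "\<dots> \<le> 2 powr r * (a powr r + b powr r)" by (auto simp: max_def)
  finally show ?thesis .
qed

lemma Lspace_add:
  assumes f: "f \<in> Lspace M r" and g: "g \<in> Lspace M r" and r: "0 < r"
  shows "(\<lambda>x. f x + g x) \<in> Lspace M r"
proof -
  note [measurable] = Lspace_measurable[OF f] Lspace_measurable[OF g]
  have "integrable M (\<lambda>x. norm (f x + g x) powr r)"
  proof (rule Bochner_Integration.integrable_bound)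
    show "integrable M (\<lambda>x. 2 powr r * (norm (f x) powr r + norm (g x) powr r))"
      using f g by (simp add: Lspace_def)
    have "norm (f x + g x) powr r \<le> 2 powr r * (norm (f x) powr r + norm (g x) powr r)" for x
    proof -
      have "norm (f x + g x) powr r \<le> (norm (f x) + norm (g x)) powr r"
        using r by (intro powr_mono2) (auto intro: norm_triangle_ineq)
      also have "\<dots> \<le> 2 powr r * (norm (f x) powr r + norm (g x) powr r)"
        using r by (intro powr_add_le) auto
      finally show ?thesis .
    qed
    then show "AE x in M. norm (norm (f x + g x) powr r) \<le> norm (2 powr r * (norm (f x) powr r + norm (g x) powr r))"
      by (auto simp: abs_of_nonneg)
  qed measurable
  then show ?thesis by (simp add: Lspace_def)
qed

lemma Lspace_cmult:
  assumes f: "f \<in> Lspace M r"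
  shows "(\<lambda>x. c * f x) \<in> Lspace M r"
  using f by (auto simp: Lspace_def norm_mult powr_mult)

lemma Lnorm_cmult:
  assumes "0 < r"
  shows "Lnorm M r (\<lambda>x. c * f x) = norm c * Lnorm M r f"
  using assms by (simp add: Lnorm_def norm_mult powr_mult powr_powr integral_nonneg_AE)

lemma Lspace_diff:
  assumes f: "f \<in> Lspace M r" and g: "g \<in> Lspace M r" and r: "0 < r"
  shows "(\<lambda>x. f x - g x) \<in> Lspace M r"
  using Lspace_add[OF f Lspace_cmult[OF g, of "-1"] r] by simp

lemma (in finite_measure) Lspace_antimono:
  assumes f: "f \<in> Lspace M r" and "0 < t" "t \<le> r"
  shows "f \<in> Lspace M t"
proof -
  note [measurable] = Lspace_measurable[OF f]
  have "integrable M (\<lambda>x. norm (f x) powr t)"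
  proof (rule Bochner_Integration.integrable_bound)
    show "integrable M (\<lambda>x. 1 + norm (f x) powr r)"
      using f by (simp add: Lspace_def)
    have "norm (f x) powr t \<le> 1 + norm (f x) powr r" for x
    proof (cases "norm (f x) \<le> 1")
      case True
      then have "norm (f x) powr t \<le> 1" using assms by (intro powr_le1) auto
      moreover have "0 \<le> norm (f x) powr r" by simp
      ultimately show ?thesis by linarith
    next
      case False
      then have "norm (f x) powr t \<le> norm (f x) powr r" using assms by (intro powr_mono) auto
      then show ?thesis by simp
    qed
    then show "AE x in M. norm (norm (f x) powr t) \<le> norm (1 + norm (f x) powr r)"
      by (auto simp: abs_of_nonneg)
  qed measurable
  then show ?thesis using f by (simp add: Lspace_def)
qed

lemma (in finite_measure) bdd_meas_Lspace:
  assumes u: "u \<in> bdd_meas M" and "0 \<le> r"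
  shows "u \<in> Lspace M r"
proof -
  note [measurable] = bdd_meas_measurable[OF u]
  obtain B where B: "\<And>x. norm (u x) \<le> B" using u by (auto simp: bdd_meas_def)
  have "integrable M (\<lambda>x. norm (u x) powr r)"
    using B assms by (intro integrable_const_bound[where B="B powr r"]) (auto intro!: powr_mono2)
  then show ?thesis by (simp add: Lspace_def)
qed

lemma Lspace_cnj [simp]: "(\<lambda>x. cnj (u x)) \<in> Lspace M r \<longleftrightarrow> u \<in> Lspace M r"
proof -
  have "(\<lambda>x. cnj (u x)) \<in> borel_measurable M \<longleftrightarrow> u \<in> borel_measurable M"
    using borel_measurable_cnj[of "\<lambda>x. cnj (u x)" M] borel_measurable_cnj[of u M]
    unfolding complex_cnj_cnj by blast
  then show ?thesis by (simp add: Lspace_def)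
qed

lemma Lnorm_cnj [simp]: "Lnorm M r (\<lambda>x. cnj (u x)) = Lnorm M r u"
  by (simp add: Lnorm_def)

lemma bdd_meas_restrict:
  assumes [measurable]: "f \<in> borel_measurable M" "Measurable.pred M Q"
    and "\<And>x. Q x \<Longrightarrow> norm (f x) \<le> B"
  shows "(\<lambda>x. if Q x then f x else 0) \<in> bdd_meas M"
proof -
  have "norm (if Q x then f x else 0) \<le> max B 0" for x using assms(3)[of x] by auto
  moreover have "(\<lambda>x. if Q x then f x else 0) \<in> borel_measurable M" by measurable
  ultimately show ?thesis unfolding bdd_meas_def by blast
qed

text \<open>
  Young's inequality gives integrability, and applied to \<open>f\<close> and \<open>g\<close> divided by their norms it
  gives the bound; a factor of norm zero vanishes almost everywhere.
\<close>
lemma Holder: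
  assumes f: "f \<in> Lspace M r" and g: "g \<in> Lspace M s" and r: "1 < r" and rs: "1/r + 1/s = 1"
  shows integrable_Holder: "integrable M (\<lambda>x. f x * g x)"
    and integral_norm_Holder: "(\<integral>x. norm (f x * g x) \<partial>M) \<le> Lnorm M r f * Lnorm M s g"
proof -
  note [measurable] = Lspace_measurable[OF f] Lspace_measurable[OF g]
  have s: "1 < s" by (rule conjugate_exponent[OF r rs])
  have Y: "norm (f x * g x) \<le> norm (f x) powr r / r + norm (g x) powr s / s" for x
    unfolding norm_mult using r s rs by (intro Youngs_inequality) auto
  show int: "integrable M (\<lambda>x. f x * g x)"
  proof (rule Bochner_Integration.integrable_bound)
    show "integrable M (\<lambda>x. norm (f x) powr r / r + norm (g x) powr s / s)"
      using f g by (simp add: Lspace_def)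
    show "AE x in M. norm (f x * g x) \<le> norm (norm (f x) powr r / r + norm (g x) powr s / s)"
      using Y r s by (auto simp: abs_of_nonneg)
  qed measurable
  define F G where "F = Lnorm M r f" and "G = Lnorm M s g"
  show "(\<integral>x. norm (f x * g x) \<partial>M) \<le> F * G"
  proof (cases "F = 0 \<or> G = 0")
    case True
    have z: "AE x in M. h x = 0" if "h \<in> Lspace M t" "Lnorm M t h = 0" for h t
    proof -
      have "(\<integral>x. norm (h x) powr t \<partial>M) = 0" using that by (simp add: Lnorm_def)
      then have "AE x in M. norm (h x) powr t = 0"
        using that by (subst (asm) integral_nonneg_eq_0_iff_AE) (auto simp: Lspace_def)
      then show ?thesis by simp
    qed
    have "AE x in M. norm (f x * g x) = 0"
      using True z[OF f] z[OF g] unfolding F_def G_def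
      by (auto elim: AE_mp)
    then have "(\<integral>x. norm (f x * g x) \<partial>M) = 0" by (rule integral_eq_zero_AE)
    then show ?thesis by (simp add: F_def G_def)
  next
    case False
    then have FG: "0 < F" "0 < G" by (auto simp: F_def G_def less_le)
    have "(\<integral>x. norm (f x * g x) \<partial>M)
       \<le> (\<integral>x. F * G * (norm (f x) powr r / (r * F powr r) + norm (g x) powr s / (s * G powr s)) \<partial>M)"
    proof (rule integral_mono)
      show "integrable M (\<lambda>x. F * G * (norm (f x) powr r / (r * F powr r) + norm (g x) powr s / (s * G powr s)))"
        using f g by (simp add: Lspace_def)
      fix x
      have "(norm (f x) / F) * (norm (g x) / G) \<le> (norm (f x) / F) powr r / r + (norm (g x) / G) powr s / s"
        using r s rs FG by (intro Youngs_inequality) auto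
      also have "\<dots> = norm (f x) powr r / (r * F powr r) + norm (g x) powr s / (s * G powr s)"
        using FG by (simp add: powr_divide mult.commute)
      finally have "(F * G) * ((norm (f x) / F) * (norm (g x) / G)) \<le> (F * G) * (norm (f x) powr r / (r * F powr r) + norm (g x) powr s / (s * G powr s))"
        using FG by (intro mult_left_mono) auto
      then show "norm (f x * g x) \<le> F * G * (norm (f x) powr r / (r * F powr r) + norm (g x) powr s / (s * G powr s))"
        using FG by (simp add: norm_mult)
    qed (use int in simp)
    also have "\<dots> = F * G * ((\<integral>x. norm (f x) powr r \<partial>M) / (r * F powr r) + (\<integral>x. norm (g x) powr s \<partial>M) / (s * G powr s))"
      using f g by (simp add: Lspace_def)
    also have "\<dots> = F * G * (1/r + 1/s)"
    proof -
      have "(\<integral>x. norm (f x) powr r \<partial>M) = F powr r" "(\<integral>x. norm (g x) powr s \<partial>M) = G powr s"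
        using r s by (simp_all add: F_def G_def Lnorm_powr)
      then show ?thesis using FG by simp
    qed
    finally show ?thesis using rs by simp
  qed
qed

lemma Holder_cnj:
  assumes f: "f \<in> Lspace M r" and g: "g \<in> Lspace M s" and r: "1 < r" and rs: "1/r + 1/s = 1"
  shows integrable_Holder_cnj: "integrable M (\<lambda>x. f x * cnj (g x))"
    and norm_integral_Holder_cnj: "norm (\<integral>x. f x * cnj (g x) \<partial>M) \<le> Lnorm M r f * Lnorm M s g"
proof -
  have g': "(\<lambda>x. cnj (g x)) \<in> Lspace M s" using g by simp
  show 1: "integrable M (\<lambda>x. f x * cnj (g x))"
    by (rule integrable_Holder[OF f g' r rs])
  have "norm (\<integral>x. f x * cnj (g x) \<partial>M) \<le> (\<integral>x. norm (f x * cnj (g x)) \<partial>M)"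
    by (rule integral_norm_bound)
  also have "\<dots> \<le> Lnorm M r f * Lnorm M s g"
    using integral_norm_Holder[OF f g' r rs] by simp
  finally show "norm (\<integral>x. f x * cnj (g x) \<partial>M) \<le> Lnorm M r f * Lnorm M s g" .
qed

text \<open>
  The way in which all norms are estimated below. The point is that \<open>h\<close> is only assumed to be
  measurable, so that testing against bounded functions also proves membership in \<open>Lspace M r\<close>.
  The test function is the extremal one for Hoelder's inequality, cut off where \<open>norm (h x) > n\<close>,
  so that the integral \<open>I n\<close> of \<open>norm (h x) powr r\<close> over the remaining set is finite and can be
  cancelled; Fatou's lemma then removes the cut-off.
\<close>
lemma (in finite_measure) converse_Holder:
  assumes h [measurable]: "h \<in> borel_measurable M" and r: "1 < r" and rs: "1/r + 1/s = 1" and K: "0 \<le> K"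
    and bd: "\<And>v. v \<in> bdd_meas M \<Longrightarrow> norm (\<integral>x. h x * cnj (v x) \<partial>M) \<le> K * Lnorm M s v"
  shows "h \<in> Lspace M r \<and> Lnorm M r h \<le> K"
proof -
  have s: "s = r / (r - 1)" by (rule conjugate_exponent[OF r rs])
  have s0: "0 < s" using conjugate_exponent(2)[OF r rs] by simp
  define I where "I = (\<lambda>n::nat. \<integral>x. (if norm (h x) \<le> n then norm (h x) powr r else 0) \<partial>M)"
  have intI: "integrable M (\<lambda>x. if norm (h x) \<le> real n then norm (h x) powr r else 0)" for n
    using r by (intro integrable_const_bound[where B="n powr r"]) (auto intro!: powr_mono2)
  have I0: "0 \<le> I n" for n unfolding I_def by (intro Bochner_Integration.integral_nonneg) auto
  have I: "I n \<le> K powr r" for n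
  proof -
    define v where "v = (\<lambda>x. if norm (h x) \<le> n then h x * of_real (norm (h x) powr (r - 2)) else 0)"
    have nv: "norm (h x * of_real (norm (h x) powr (r - 2))) = norm (h x) powr (r - 1)" for x
    proof (cases "h x = 0")
      case False
      then show ?thesis by (simp add: norm_mult powr_mult_base)
    qed simp
    have v: "v \<in> bdd_meas M"
      unfolding v_def
    proof (rule bdd_meas_restrict)
      show "norm (h x * of_real (norm (h x) powr (r - 2))) \<le> real n powr (r - 1)" if "norm (h x) \<le> n" for x
        unfolding nv using r that by (intro powr_mono2) auto
    qed measurable
    have "norm (v x) powr s = (if norm (h x) \<le> n then norm (h x) powr r else 0)" for x
      unfolding v_def using r s0 by (auto simp: nv powr_powr s simp del: norm_mult)
    then have Nv: "Lnorm M s v = I n powr (1/s)" by (simp add: Lnorm_def I_def)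
    have "h x * cnj (v x) = complex_of_real (if norm (h x) \<le> real n then norm (h x) powr r else 0)" for x
    proof (cases "h x = 0")
      case False
      then have "norm (h x) powr r = (norm (h x))\<^sup>2 * norm (h x) powr (r - 2)"
        by (simp add: powr_diff powr_numeral)
      then show ?thesis
        using complex_norm_square[of "h x"] by (simp add: v_def flip: mult.assoc)
    qed (simp add: v_def)
    then have "(\<integral>x. h x * cnj (v x) \<partial>M) = of_real (I n)"
      unfolding I_def by simp
    with bd[OF v] have le: "I n \<le> K * I n powr (1/s)" using I0[of n] by (simp add: Nv)
    show ?thesis
    proof (cases "I n = 0")
      case False
      then have pos: "0 < I n" using I0[of n] by simp
      have "I n powr (1/r) * I n powr (1/s) \<le> K * I n powr (1/s)"
        using le rs pos by (simp add: powr_add[symmetric])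
      then have "I n powr (1/r) \<le> K" using pos by simp
      then have "(I n powr (1/r)) powr r \<le> K powr r" using r by (intro powr_mono2) auto
      then show ?thesis using pos r by (simp add: powr_powr)
    qed simp
  qed
  have "(\<integral>\<^sup>+x. ennreal (norm (h x) powr r) \<partial>M) \<le> ennreal (K powr r)"
  proof -
    let ?H = "\<lambda>n x. ennreal (if norm (h x) \<le> real n then norm (h x) powr r else 0)"
    have "ennreal (norm (h x) powr r) = liminf (\<lambda>n. ?H n x)" for x
    proof -
      have "(\<lambda>n. ?H n x) \<longlonglongrightarrow> ennreal (norm (h x) powr r)"
      proof (rule tendsto_eventually)
        show "\<forall>\<^sub>F n in sequentially. ?H n x = ennreal (norm (h x) powr r)"
          using eventually_ge_at_top[of "nat \<lceil>norm (h x)\<rceil>"] by eventually_elim (auto simp: nat_ceiling_le_eq)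
      qed
      then show ?thesis by (rule lim_imp_Liminf[OF sequentially_bot, symmetric])
    qed
    then have "(\<integral>\<^sup>+x. ennreal (norm (h x) powr r) \<partial>M) = (\<integral>\<^sup>+x. liminf (\<lambda>n. ?H n x) \<partial>M)" by simp
    also have "\<dots> \<le> liminf (\<lambda>n. \<integral>\<^sup>+x. ?H n x \<partial>M)"
      by (rule nn_integral_liminf) measurable
    also have "(\<integral>\<^sup>+x. ?H n x \<partial>M) = ennreal (I n)" for n
      unfolding I_def by (rule nn_integral_eq_integral[OF intI]) auto
    then have "liminf (\<lambda>n. \<integral>\<^sup>+x. ?H n x \<partial>M) = liminf (\<lambda>n. ennreal (I n))" by simp
    also have "\<dots> \<le> ennreal (K powr r)"
      using I by (intro Liminf_le) (auto intro: ennreal_leI)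
    finally show ?thesis .
  qed
  then have fin: "(\<integral>\<^sup>+x. ennreal (norm (norm (h x) powr r)) \<partial>M) \<le> ennreal (K powr r)" by simp
  have hint: "integrable M (\<lambda>x. norm (h x) powr r)"
    by (rule integrableI_bounded) (use fin in \<open>auto intro: le_less_trans\<close>)
  then have "(\<integral>x. norm (h x) powr r \<partial>M) \<le> K powr r"
    using fin by (subst (asm) nn_integral_eq_integral) (auto)
  then have "Lnorm M r h \<le> (K powr r) powr (1/r)"
    unfolding Lnorm_def using r by (intro powr_mono2 Bochner_Integration.integral_nonneg) auto
  also have "\<dots> = K" using r K by (simp add: powr_powr)
  finally show ?thesis using hint by (simp add: Lspace_def)
qed

text \<open>
  Hoelder's inequality with exponent \<open>r / t\<close> for \<open>norm (f x) powr t\<close> and the constant function \<open>1\<close>.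
\<close>
lemma (in finite_measure) Lnorm_embedding:
  assumes "1 \<le> t" "t \<le> r"
  obtains C where "0 \<le> C" "\<And>f. f \<in> Lspace M r \<Longrightarrow> Lnorm M t f \<le> C * Lnorm M r f"
proof (cases "t = r")
  case True
  show ?thesis by (rule that[of 1]) (auto simp: True)
next
  case False
  define a where "a = r / t"
  define b where "b = a / (a - 1)"
  have a: "1 < a" using False assms by (simp add: a_def)
  have ab: "1/a + 1/b = 1" using a by (simp add: b_def field_simps)
  define C where "C = (Lnorm M b (\<lambda>_. 1)) powr (1/t)"
  show ?thesis
  proof (rule that[of C])
    show "0 \<le> C" by (simp add: C_def)
    fix f assume f: "f \<in> Lspace M r"
    note [measurable] = Lspace_measurable[OF f]
    define g where "g = (\<lambda>x. complex_of_real (norm (f x) powr t))"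
    have ng: "norm (g x) powr a = norm (f x) powr r" for x
      using assms by (simp add: g_def powr_powr a_def)
    have "g \<in> borel_measurable M" unfolding g_def by measurable
    then have g: "g \<in> Lspace M a"
      using f by (simp add: Lspace_def ng)
    have 1: "(\<lambda>_. 1) \<in> Lspace M b" by (simp add: Lspace_def)
    have "(\<integral>x. norm (f x) powr t \<partial>M) \<le> Lnorm M a g * Lnorm M b (\<lambda>_. 1)"
      using integral_norm_Holder[OF g 1 a ab] by (simp add: g_def)
    then have "Lnorm M t f \<le> (Lnorm M a g * Lnorm M b (\<lambda>_. 1)) powr (1/t)"
      unfolding Lnorm_def[of M t] using assms by (intro powr_mono2 Bochner_Integration.integral_nonneg) auto
    also have "\<dots> = C * Lnorm M r f"
    proof -
      have "1 / a * (1 / t) = 1 / r" using assms by (simp add: a_def)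
      then have "Lnorm M a g powr (1/t) = Lnorm M r f"
        by (simp only: Lnorm_def ng powr_powr)
      then show ?thesis by (simp add: powr_mult C_def)
    qed
    finally show "Lnorm M t f \<le> C * Lnorm M r f" .
  qed
qed

lemma truncation_tendsto:
  assumes g: "g \<in> Lspace M r" and r: "0 < r"
  shows "(\<lambda>n. Lnorm M r (\<lambda>x. g x - (if norm (g x) \<le> real n then g x else 0))) \<longlonglongrightarrow> 0"
proof -
  note [measurable] = Lspace_measurable[OF g]
  have "(\<lambda>n. \<integral>x. norm (g x - (if norm (g x) \<le> real n then g x else 0)) powr r \<partial>M) \<longlonglongrightarrow> (\<integral>x. 0 \<partial>M)"
  proof (rule integral_dominated_convergence[where w="\<lambda>x. norm (g x) powr r"])
    show "AE x in M. (\<lambda>n. norm (g x - (if norm (g x) \<le> real n then g x else 0)) powr r) \<longlonglongrightarrow> 0"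
    proof (rule AE_I2, rule tendsto_eventually)
      fix x
      show "\<forall>\<^sub>F n in sequentially. norm (g x - (if norm (g x) \<le> real n then g x else 0)) powr r = 0"
        using eventually_ge_at_top[of "nat \<lceil>norm (g x)\<rceil>"] by eventually_elim (auto simp: nat_ceiling_le_eq)
    qed
  qed (use g in \<open>auto simp: Lspace_def\<close>)
  then have "(\<lambda>n. (\<integral>x. norm (g x - (if norm (g x) \<le> real n then g x else 0)) powr r \<partial>M) powr (1/r)) \<longlonglongrightarrow> 0 powr (1/r)"
    using r by (intro tendsto_powr') auto
  then show ?thesis by (simp add: Lnorm_def)
qed

section \<open>The uniform boundedness principle in Lebesgue spaces\<close>

text \<open>
  For any \<open>s\<close> and \<open>z\<close>, one of \<open>s + z\<close> and \<open>s - z\<close> has norm at least \<open>norm z\<close>; so each sign can be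
  chosen, after the previous ones, to prevent cancellation of the diagonal term.
\<close>
lemma choose_signs:
  fixes a :: "nat \<Rightarrow> nat \<Rightarrow> complex"
  obtains \<sigma> :: "nat \<Rightarrow> real" where "\<And>k. \<bar>\<sigma> k\<bar> = 1"
    "\<And>n. norm (a n n) \<le> norm (\<Sum>k\<le>n. of_real (\<sigma> k) * a k n)"
proof -
  define P where "P = (\<lambda>(f::nat \<Rightarrow> real) n (r::real). \<bar>r\<bar> = 1 \<and>
     norm (a n n) \<le> norm ((\<Sum>k<n. of_real (f k) * a k n) + of_real r * a n n))"
  have "\<exists>f. \<forall>n. P f n (f n)"
  proof (rule dependent_wellorder_choice)
    fix r :: real and f g :: "nat \<Rightarrow> real" and n :: nat
    assume "\<And>y. y < n \<Longrightarrow> f y = g y"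
    then have "(\<Sum>k<n. complex_of_real (f k) * a k n) = (\<Sum>k<n. of_real (g k) * a k n)"
      by (intro sum.cong) auto
    then show "P f n r = P g n r" by (simp add: P_def)
  next
    fix n :: nat and f :: "nat \<Rightarrow> real"
    define s where "s = (\<Sum>k<n. complex_of_real (f k) * a k n)"
    have "norm (a n n) \<le> norm (s + a n n) \<or> norm (a n n) \<le> norm (s - a n n)"
    proof (rule ccontr)
      assume "\<not> ?thesis"
      moreover have "norm (2 * a n n) \<le> norm (s + a n n) + norm (s - a n n)"
        using norm_triangle_ineq4[of "s + a n n" "s - a n n"] by (simp add: algebra_simps)
      ultimately show False by (simp add: norm_mult)
    qed
    then show "\<exists>r. P f n r"
    proof
      assume "norm (a n n) \<le> norm (s + a n n)"
      then show ?thesis by (intro exI[of _ 1]) (simp add: P_def s_def)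
    next
      assume "norm (a n n) \<le> norm (s - a n n)"
      then show ?thesis by (intro exI[of _ "-1"]) (simp add: P_def s_def)
    qed
  qed
  then obtain f where f: "\<And>n. P f n (f n)" by blast
  show ?thesis
  proof (rule that[of f])
    show "\<bar>f k\<bar> = 1" for k using f[of k] by (simp add: P_def)
    show "norm (a n n) \<le> norm (\<Sum>k\<le>n. of_real (f k) * a k n)" for n
      using f[of n] by (simp add: P_def lessThan_Suc_atMost[symmetric])
  qed
qed

lemma AE_summable_norm:
  fixes f :: "nat \<Rightarrow> 'a \<Rightarrow> complex"
  assumes f: "\<And>i. integrable M (f i)" and sm: "summable (\<lambda>i. \<integral>x. norm (f i x) \<partial>M)"
  shows "AE x in M. summable (\<lambda>i. norm (f i x))"
proof -
  have [measurable]: "f i \<in> borel_measurable M" for i using f by auto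
  have "(\<integral>\<^sup>+x. (\<Sum>i. ennreal (norm (f i x))) \<partial>M) = (\<Sum>i. \<integral>\<^sup>+x. ennreal (norm (f i x)) \<partial>M)"
    by (rule nn_integral_suminf) measurable
  also have "\<dots> = (\<Sum>i. ennreal (\<integral>x. norm (f i x) \<partial>M))"
    using f by (intro arg_cong[where f=suminf] ext nn_integral_eq_integral) auto
  also have "\<dots> \<noteq> \<infinity>"
    using sm by (simp add: ennreal_suminf_neq_top)
  finally have "AE x in M. (\<Sum>i. ennreal (norm (f i x))) \<noteq> \<infinity>"
    by (intro nn_integral_PInf_AE) measurable
  then show ?thesis
    by eventually_elim (auto intro: summable_suminf_not_top)
qed

text \<open>
  Near-extremal functions for the norm of \<open>g\<close>; the factor \<open>1 / 2\<close> avoids attaining the supremum.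
\<close>
lemma (in finite_measure) converse_Holder_witness:
  assumes g: "g \<in> Lspace M q" and q: "1 < q" and qp: "1/q + 1/p = 1" and pos: "0 < Lnorm M q g"
  obtains u where "u \<in> bdd_meas M" "Lnorm M p u = 1" "Lnorm M q g / 2 \<le> norm (\<integral>x. u x * cnj (g x) \<partial>M)"
proof -
  let ?N = "Lnorm M q g"
  have p: "1 < p" by (rule conjugate_exponent[OF q qp])
  note [measurable] = Lspace_measurable[OF g]
  have "\<exists>v\<in>bdd_meas M. \<not> norm (\<integral>x. g x * cnj (v x) \<partial>M) \<le> ?N / 2 * Lnorm M p v"
  proof (rule ccontr)
    assume "\<not> ?thesis"
    then have "g \<in> Lspace M q \<and> ?N \<le> ?N / 2"
      by (intro converse_Holder[OF _ q qp]) auto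
    then show False using pos by simp
  qed
  then obtain v where v: "v \<in> bdd_meas M" "?N / 2 * Lnorm M p v < norm (\<integral>x. g x * cnj (v x) \<partial>M)"
    by (auto simp: not_le)
  note [measurable] = bdd_meas_measurable[OF v(1)]
  have vL: "v \<in> Lspace M p" using bdd_meas_Lspace[OF v(1)] p by simp
  define c where "c = Lnorm M p v"
  have c: "0 < c"
  proof (rule ccontr)
    assume "\<not> 0 < c"
    then have "Lnorm M p v = 0" using Lnorm_nonneg[of M p v] by (simp add: c_def)
    then show False using norm_integral_Holder_cnj[OF g vL q qp] v(2) by simp
  qed
  define u where "u = (\<lambda>x. complex_of_real (1/c) * v x)"
  show ?thesis
  proof (rule that[of u])
    obtain B where "\<And>x. norm (v x) \<le> B" using v(1) by (auto simp: bdd_meas_def)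
    then have "norm (u x) \<le> B / c" for x using c by (simp add: u_def norm_mult norm_divide divide_right_mono)
    moreover have "u \<in> borel_measurable M" unfolding u_def by measurable
    ultimately show "u \<in> bdd_meas M" unfolding bdd_meas_def by blast
    show "Lnorm M p u = 1"
      unfolding u_def using p c Lnorm_cmult[of p M "complex_of_real (1/c)" v] by (simp add: norm_divide c_def[symmetric])
    have "(\<integral>x. u x * cnj (g x) \<partial>M) = complex_of_real (1/c) * (\<integral>x. v x * cnj (g x) \<partial>M)"
      unfolding u_def mult.assoc by simp
    also have "(\<integral>x. v x * cnj (g x) \<partial>M) = cnj (\<integral>x. g x * cnj (v x) \<partial>M)" by (rule integral_pairing_cnj)
    finally have "norm (\<integral>x. u x * cnj (g x) \<partial>M) = norm (\<integral>x. g x * cnj (v x) \<partial>M) / c"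
      using c by (simp add: norm_mult norm_divide)
    then show "?N / 2 \<le> norm (\<integral>x. u x * cnj (g x) \<partial>M)"
      using v(2) c by (simp add: c_def[symmetric] pos_le_divide_eq)
  qed
qed

text \<open>
  The uniform boundedness principle for the functionals that \<open>G\<close> induces on \<open>Lspace M p\<close>, by a
  gliding hump. If the norms were unbounded, take \<open>g n\<close> in \<open>G\<close> of norm above \<open>8 ^ n\<close>, near-extremal
  unit vectors \<open>u n\<close>, and the series \<open>X\<close> of the \<open>u n\<close> with coefficients \<open>\<sigma> n * (1/4) ^ n\<close>. The signs
  keep the partial sum up to \<open>n\<close> paired with \<open>g n\<close> at least \<open>(1/4) ^ n * N / 2\<close>, where \<open>N\<close> is the
  norm of \<open>g n\<close>, whereas the tail contributes at most \<open>(1/4) ^ n * N / 3\<close>. The pairings with \<open>X\<close>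
  are therefore unbounded. Completeness of \<open>Lspace M p\<close> enters through the existence of \<open>X\<close>, which
  converges in mean and belongs to \<open>Lspace M p\<close> by the converse of Hoelder's inequality.
\<close>
lemma (in finite_measure) uniform_boundedness_Lspace:
  assumes q: "1 < q" and qp: "1/q + 1/p = 1" and G: "G \<subseteq> Lspace M q"
    and pb: "\<And>u. u \<in> Lspace M p \<Longrightarrow> \<exists>K. \<forall>g\<in>G. norm (\<integral>x. u x * cnj (g x) \<partial>M) \<le> K"
  shows "\<exists>C. \<forall>g\<in>G. Lnorm M q g \<le> C"
proof (rule ccontr)
  assume "\<not> ?thesis"
  then have "\<forall>n::nat. \<exists>g\<in>G. 8 ^ n < Lnorm M q g" by (meson not_le)
  then obtain g where g: "\<And>n::nat. g n \<in> G" "\<And>n. 8 ^ n < Lnorm M q (g n)" by metis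
  have p: "1 < p" by (rule conjugate_exponent[OF q qp])
  have pq: "1/p + 1/q = 1" using qp by simp
  have gL: "g n \<in> Lspace M q" for n using g G by auto
  have "\<exists>u\<in>bdd_meas M. Lnorm M p u = 1 \<and> Lnorm M q (g n) / 2 \<le> norm (\<integral>x. u x * cnj (g n x) \<partial>M)" for n
  proof -
    have "0 < Lnorm M q (g n)" by (rule less_trans[OF _ g(2)]) simp
    from converse_Holder_witness[OF gL q qp this] show ?thesis by blast
  qed
  then obtain u where u: "\<And>n. u n \<in> bdd_meas M" "\<And>n. Lnorm M p (u n) = 1"
     "\<And>n. Lnorm M q (g n) / 2 \<le> norm (\<integral>x. u n x * cnj (g n x) \<partial>M)"
    by metis
  have uL: "u n \<in> Lspace M p" for n using bdd_meas_Lspace[OF u(1)] p by simp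
  \<comment> \<open>Any ratio below \<open>1 / 3\<close> makes the tail \<open>b ^ n * b / (1 - b)\<close> smaller than \<open>b ^ n / 2\<close>.\<close>
  define b where "b = (1/4 :: real)"
  obtain \<sigma> :: "nat \<Rightarrow> real" where s: "\<And>k. \<bar>\<sigma> k\<bar> = 1"
    "\<And>n. norm (b ^ n * (\<integral>x. u n x * cnj (g n x) \<partial>M))
        \<le> norm (\<Sum>k\<le>n. of_real (\<sigma> k) * (b ^ k * (\<integral>x. u k x * cnj (g n x) \<partial>M)))"
    using choose_signs[of "\<lambda>k n. of_real (b ^ k) * (\<integral>x. u k x * cnj (g n x) \<partial>M)"] by auto
  define f where "f = (\<lambda>k x. complex_of_real (\<sigma> k * b ^ k) * u k x)"
  have nc: "norm (complex_of_real (\<sigma> k * b ^ k)) = b ^ k" for k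
    using s(1)[of k] by (simp add: norm_mult norm_power b_def)
  have sb: "summable (\<lambda>k. b ^ k)" by (rule summable_geometric) (simp add: b_def)
  define J where "J = (\<lambda>w k. complex_of_real (\<sigma> k * b ^ k) * (\<integral>x. u k x * cnj (w x) \<partial>M))"
  have Jb: "norm (J w k) \<le> b ^ k * Lnorm M q w" if "w \<in> Lspace M q" for w k
  proof -
    have "norm (\<integral>x. u k x * cnj (w x) \<partial>M) \<le> Lnorm M q w"
      using norm_integral_Holder_cnj[OF uL that p pq] by (simp add: u)
    then show ?thesis unfolding J_def norm_mult nc by (intro mult_left_mono) (auto simp: b_def)
  qed
  have fi: "integrable M (\<lambda>x. f k x * cnj (w x))"
      and fs: "summable (\<lambda>k. \<integral>x. norm (f k x * cnj (w x)) \<partial>M)"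
      and fJ: "(\<integral>x. f k x * cnj (w x) \<partial>M) = J w k" if w: "w \<in> Lspace M q" for w k
  proof -
    have w': "(\<lambda>x. cnj (w x)) \<in> Lspace M q" using w by simp
    show "integrable M (\<lambda>x. f k x * cnj (w x))" for k
      unfolding f_def mult.assoc using integrable_Holder_cnj[OF uL w p pq] by simp
    show "(\<integral>x. f k x * cnj (w x) \<partial>M) = J w k"
      unfolding f_def mult.assoc J_def by simp
    show "summable (\<lambda>k. \<integral>x. norm (f k x * cnj (w x)) \<partial>M)"
    proof (rule summable_comparison_test[OF _ summable_mult2[OF sb, of "Lnorm M q w"]], intro exI allI impI)
      fix k
      have "(\<integral>x. norm (f k x * cnj (w x)) \<partial>M) = b ^ k * (\<integral>x. norm (u k x * cnj (w x)) \<partial>M)"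
        unfolding f_def mult.assoc norm_mult[of "complex_of_real (\<sigma> k * b ^ k)"] nc by simp
      also have "\<dots> \<le> b ^ k * Lnorm M q w"
        using integral_norm_Holder[OF uL w' p pq] by (intro mult_left_mono) (auto simp: u b_def)
      finally show "norm (\<integral>x. norm (f k x * cnj (w x)) \<partial>M) \<le> b ^ k * Lnorm M q w"
        by (simp add: abs_of_nonneg Bochner_Integration.integral_nonneg)
    qed
  qed
  \<comment> \<open>Pairing with the constant \<open>1\<close> gives the almost everywhere convergence of the series.\<close>
  have one: "(\<lambda>_. 1) \<in> Lspace M q" by (simp add: Lspace_def)
  have AEf: "AE x in M. summable (\<lambda>k. norm (f k x))"
    using AE_summable_norm[of M "\<lambda>k x. f k x * cnj 1"] fi[OF one] fs[OF one] by simp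
  define X where "X = (\<lambda>x. \<Sum>k. f k x)"
  have fm [measurable]: "f k \<in> borel_measurable M" for k
    using bdd_meas_measurable[OF u(1)[of k]] unfolding f_def by measurable
  have Xm [measurable]: "X \<in> borel_measurable M" unfolding X_def by measurable
  have sums: "J w sums (\<integral>x. X x * cnj (w x) \<partial>M)" if w: "w \<in> Lspace M q" for w
  proof -
    note [measurable] = Lspace_measurable[OF w]
    have AEw: "AE x in M. summable (\<lambda>k. norm (f k x * cnj (w x)))"
      by (rule AE_summable_norm[OF fi[OF w] fs[OF w]])
    have "(\<lambda>k. \<integral>x. f k x * cnj (w x) \<partial>M) sums (\<integral>x. (\<Sum>k. f k x * cnj (w x)) \<partial>M)"
      by (rule sums_integral[OF fi[OF w] AEw fs[OF w]])
    also have "(\<integral>x. (\<Sum>k. f k x * cnj (w x)) \<partial>M) = (\<integral>x. X x * cnj (w x) \<partial>M)"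
    proof (rule integral_cong_AE)
      show "AE x in M. (\<Sum>k. f k x * cnj (w x)) = X x * cnj (w x)"
        using AEf
      proof eventually_elim
        case (elim x)
        then show ?case unfolding X_def
          using suminf_mult2[OF summable_norm_cancel[OF elim], of "cnj (w x)"] by simp
      qed
    qed measurable
    finally show ?thesis by (simp add: fJ[OF w])
  qed
  have sJ: "summable (\<lambda>k. norm (J w k))" if "w \<in> Lspace M q" for w
    by (rule summable_comparison_test[OF _ summable_mult2[OF sb, of "Lnorm M q w"]])
      (use Jb[OF that] in auto)
  have gs: "(\<Sum>k. b ^ k) = 4/3" by (subst suminf_geometric) (auto simp: b_def)
  have "X \<in> Lspace M p \<and> Lnorm M p X \<le> 4/3"
  proof (rule converse_Holder[OF Xm p pq])
    fix w assume "w \<in> bdd_meas M"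
    then have w: "w \<in> Lspace M q" using q bdd_meas_Lspace by auto
    have "norm (\<integral>x. X x * cnj (w x) \<partial>M) = norm (\<Sum>k. J w k)"
      using sums_unique[OF sums[OF w]] by simp
    also have "\<dots> \<le> (\<Sum>k. norm (J w k))" by (rule summable_norm[OF sJ[OF w]])
    also have "\<dots> \<le> (\<Sum>k. b ^ k * Lnorm M q w)"
      by (rule suminf_le[OF Jb[OF w] sJ[OF w] summable_mult2[OF sb]])
    also have "\<dots> = 4/3 * Lnorm M q w" using suminf_mult2[OF sb, of "Lnorm M q w"] gs by simp
    finally show "norm (\<integral>x. X x * cnj (w x) \<partial>M) \<le> 4/3 * Lnorm M q w" .
  qed simp
  then obtain K where K: "\<And>n. norm (\<integral>x. X x * cnj (g n x) \<partial>M) \<le> K"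
    using pb[of X] g(1) by blast
  have "2 ^ n / 6 \<le> K" for n
  proof -
    let ?N = "Lnorm M q (g n)"
    let ?tail = "\<Sum>k. J (g n) (k + Suc n)"
    note J = Jb[OF gL[of n]] and sJn = sJ[OF gL[of n]]
    have "(\<integral>x. X x * cnj (g n x) \<partial>M) = (\<Sum>k. J (g n) k)"
      using sums_unique[OF sums[OF gL[of n]]] by simp
    also have "\<dots> = ?tail + (\<Sum>k<Suc n. J (g n) k)"
      by (rule suminf_split_initial_segment[OF summable_norm_cancel[OF sJn]])
    finally have "norm (\<Sum>k<Suc n. J (g n) k) \<le> norm (\<integral>x. X x * cnj (g n x) \<partial>M) + norm ?tail"
      by (metis add_diff_cancel_left' norm_triangle_ineq4)
    moreover have "norm ?tail \<le> b ^ n * ?N / 3"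
    proof -
      have st: "summable (\<lambda>k. norm (J (g n) (k + Suc n)))" using sJn by (subst summable_iff_shift)
      have "norm ?tail \<le> (\<Sum>k. norm (J (g n) (k + Suc n)))" by (rule summable_norm[OF st])
      also have "\<dots> \<le> (\<Sum>k. b ^ k * (b ^ Suc n * ?N))"
      proof (rule suminf_le[OF _ st summable_mult2[OF sb]])
        show "norm (J (g n) (k + Suc n)) \<le> b ^ k * (b ^ Suc n * ?N)" for k
          using J[of "k + Suc n"] by (simp only: power_add mult.assoc)
      qed
      also have "\<dots> = 4/3 * (b ^ Suc n * ?N)" using suminf_mult2[OF sb, of "b ^ Suc n * ?N"] gs by simp
      also have "\<dots> = b ^ n * ?N / 3" by (simp add: b_def)
      finally show ?thesis .
    qed
    moreover have "b ^ n * (?N / 2) \<le> norm (\<Sum>k<Suc n. J (g n) k)"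
    proof -
      have "b ^ n * (?N / 2) \<le> b ^ n * norm (\<integral>x. u n x * cnj (g n x) \<partial>M)"
        by (intro mult_left_mono u) (simp add: b_def)
      also have "\<dots> \<le> norm (\<Sum>k\<le>n. of_real (\<sigma> k) * (b ^ k * (\<integral>x. u k x * cnj (g n x) \<partial>M)))"
        using s(2)[of n] by (simp add: norm_mult norm_power b_def)
      also have "(\<Sum>k\<le>n. of_real (\<sigma> k) * (b ^ k * (\<integral>x. u k x * cnj (g n x) \<partial>M))) = (\<Sum>k<Suc n. J (g n) k)"
        by (simp add: J_def lessThan_Suc_atMost mult.assoc)
      finally show ?thesis .
    qed
    moreover have "2 ^ n \<le> b ^ n * ?N"
    proof -
      have "b ^ n * 8 ^ n \<le> b ^ n * ?N" using g(2)[of n] by (intro mult_left_mono) (auto simp: b_def)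
      then show ?thesis by (simp add: power_mult_distrib[symmetric] b_def)
    qed
    ultimately show ?thesis using K[of n] by simp
  qed
  moreover obtain n where "6 * K < 2 ^ n" using real_arch_pow[of 2 "6 * K"] by auto
  ultimately show False by (metis (no_types, opaque_lifting) divide_le_eq_numeral1(1) mult.commute not_le)
qed

section \<open>Marcinkiewicz interpolation\<close>

lemma nn_integral_powr_below:
  assumes "-1 < a" "0 \<le> c"
  shows "(\<integral>\<^sup>+l. ennreal (l powr a) * indicator {0<..<c} l \<partial>lborel) = ennreal (c powr (a+1) / (a+1))"
proof -
  have "(\<integral>\<^sup>+l. ennreal (l powr a) * indicator {0<..<c} l \<partial>lborel)
      = (\<integral>\<^sup>+l. ennreal (indicator {0..c} l * l powr a) \<partial>lborel)"
  proof (rule nn_integral_cong_AE)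
    have "AE l in lborel. l \<noteq> 0 \<and> l \<noteq> c"
      using AE_lborel_singleton[of 0] AE_lborel_singleton[of c] by eventually_elim simp
    then show "AE l in lborel. ennreal (l powr a) * indicator {0<..<c} l = ennreal (indicator {0..c} l * l powr a)"
      by eventually_elim (auto simp: indicator_def)
  qed
  also have "\<dots> = ennreal (c powr (a+1) / (a+1))"
    by (rule nn_integral_has_integral_lebesgue[OF _ has_integral_powr_from_0]) (use assms in auto)
  finally show ?thesis .
qed

lemma nn_integral_powr_above:
  assumes "a < -1" "0 < c"
  shows "(\<integral>\<^sup>+l. ennreal (l powr a) * indicator {c..} l \<partial>lborel) = ennreal (c powr (a+1) / (- a - 1))"
proof -
  have "(\<integral>\<^sup>+l. ennreal (l powr a) * indicator {c..} l \<partial>lborel)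
      = (\<integral>\<^sup>+l. ennreal (indicator {c..} l * l powr a) \<partial>lborel)"
    by (auto intro!: nn_integral_cong simp: indicator_def)
  also have "\<dots> = ennreal (- (c powr (a+1)) / (a+1))"
    by (rule nn_integral_has_integral_lebesgue[OF _ has_integral_powr_to_inf]) (use assms in auto)
  also have "- (c powr (a+1)) / (a+1) = c powr (a+1) / (- a - 1)"
    using assms by (simp add: field_simps)
  finally show ?thesis .
qed

text \<open>
  The real-variable core of Marcinkiewicz interpolation. By the layer-cake formula,
  \<open>\<integral> F powr r\<close> is the integral over \<open>l > 0\<close> of \<open>r * l powr (r - 1)\<close> times the measure of \<open>{l < F}\<close>.
  Inserting the hypothesis and exchanging integrals leaves, for each point \<open>x\<close>, an integral of
  \<open>l powr (r - q - 1)\<close> below \<open>f x\<close> and one of \<open>l powr (r - p - 1)\<close> above \<open>f x\<close>. The first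
  converges at \<open>0\<close> because \<open>q < r\<close>, the second at infinity because \<open>r < p\<close>. Multiplied by
  \<open>f x powr q\<close> and \<open>f x powr p\<close> respectively, both are constant multiples of \<open>f x powr r\<close>.
\<close>
lemma (in sigma_finite_measure) nn_integral_powr_le_of_weak_type:
  fixes F f :: "'a \<Rightarrow> real"
  assumes [measurable]: "F \<in> borel_measurable M" "f \<in> borel_measurable M"
    and F0: "\<And>x. 0 \<le> F x" and f0: "\<And>x. 0 \<le> f x"
    and A: "0 \<le> A" and B: "0 \<le> B" and qr: "0 < q" "q < r" and rp: "r < p"
    and weak: "\<And>l. 0 < l \<Longrightarrow> emeasure M {x\<in>space M. l < F x} \<le>
       ennreal (A * l powr (-q)) * (\<integral>\<^sup>+x. ennreal (f x powr q) * indicator {x. l < f x} x \<partial>M) +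
       ennreal (B * l powr (-p)) * (\<integral>\<^sup>+x. ennreal (f x powr p) * indicator {x. f x \<le> l} x \<partial>M)"
  shows "(\<integral>\<^sup>+x. ennreal (F x powr r) \<partial>M)
     \<le> ennreal (r * (A / (r - q) + B / (p - r))) * (\<integral>\<^sup>+x. ennreal (f x powr r) \<partial>M)"
proof -
  interpret pair_sigma_finite M lborel ..
  have r: "0 < r" using qr by simp
  define w where "w = (\<lambda>l::real. ennreal (r * l powr (r - 1)) * indicator {0<..} l)"
  have [measurable]: "w \<in> borel_measurable borel" unfolding w_def by measurable
  have 1: "ennreal (F x powr r) = (\<integral>\<^sup>+l. w l * indicator {l. l < F x} l \<partial>lborel)" for x
  proof -
    have "(\<integral>\<^sup>+l. w l * indicator {l. l < F x} l \<partial>lborel)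
        = (\<integral>\<^sup>+l. ennreal r * (ennreal (l powr (r - 1)) * indicator {0<..<F x} l) \<partial>lborel)"
      using r by (intro nn_integral_cong) (auto simp: w_def indicator_def ennreal_mult)
    also have "\<dots> = ennreal r * ennreal (F x powr r / r)"
      using r F0 nn_integral_powr_below[of "r - 1" "F x"] by (simp add: nn_integral_cmult)
    also have "\<dots> = ennreal (F x powr r)"
      using r by (simp add: ennreal_mult[symmetric])
    finally show ?thesis by simp
  qed
  define G1 where "G1 = (\<lambda>x l. w l * (ennreal (A * l powr (-q)) * (ennreal (f x powr q) * indicator {l. l < f x} l)))"
  define G2 where "G2 = (\<lambda>x l. w l * (ennreal (B * l powr (-p)) * (ennreal (f x powr p) * indicator {l. f x \<le> l} l)))"
  have mG1 [measurable]: "case_prod G1 \<in> borel_measurable (M \<Otimes>\<^sub>M lborel)"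
    unfolding G1_def indicator_def by measurable
  have mG2 [measurable]: "case_prod G2 \<in> borel_measurable (M \<Otimes>\<^sub>M lborel)"
    unfolding G2_def indicator_def by measurable
  have sw: "indicator {l. l < f x} l = (indicator {x. l < f x} x :: ennreal)"
     "indicator {l. f x \<le> l} l = (indicator {x. f x \<le> l} x :: ennreal)" for x l
    by (auto simp: indicator_def)
  have G1x: "(\<integral>\<^sup>+l. G1 x l \<partial>lborel) = ennreal (r * A / (r - q)) * ennreal (f x powr r)" for x
  proof -
    have "(\<integral>\<^sup>+l. G1 x l \<partial>lborel)
       = (\<integral>\<^sup>+l. ennreal (r * A * f x powr q) * (ennreal (l powr (r - q - 1)) * indicator {0<..<f x} l) \<partial>lborel)"
      using r A by (intro nn_integral_cong)
        (auto simp: G1_def w_def indicator_def ennreal_mult[symmetric] powr_diff powr_minus powr_add field_simps)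
    also have "\<dots> = ennreal (r * A * f x powr q) * ennreal (f x powr (r - q) / (r - q))"
      using qr f0 nn_integral_powr_below[of "r - q - 1" "f x"] by (simp add: nn_integral_cmult)
    also have "\<dots> = ennreal (r * A * f x powr q * (f x powr (r - q) / (r - q)))"
      using r A qr by (intro ennreal_mult[symmetric]) auto
    also have "r * A * f x powr q * (f x powr (r - q) / (r - q)) = r * A / (r - q) * f x powr r"
      using qr by (cases "f x = 0") (auto simp: powr_diff)
    also have "ennreal \<dots> = ennreal (r * A / (r - q)) * ennreal (f x powr r)"
      using r A qr by (intro ennreal_mult) auto
    finally show ?thesis .
  qed
  have G2x: "(\<integral>\<^sup>+l. G2 x l \<partial>lborel) \<le> ennreal (r * B / (p - r)) * ennreal (f x powr r)" for x
  proof (cases "f x = 0")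
    case True then show ?thesis by (simp add: G2_def)
  next
    case False
    then have fx: "0 < f x" using f0[of x] by simp
    have "(\<integral>\<^sup>+l. G2 x l \<partial>lborel)
       = (\<integral>\<^sup>+l. ennreal (r * B * f x powr p) * (ennreal (l powr (r - p - 1)) * indicator {f x..} l) \<partial>lborel)"
      using r B fx by (intro nn_integral_cong)
        (auto simp: G2_def w_def indicator_def ennreal_mult[symmetric] powr_diff powr_minus powr_add field_simps)
    also have "\<dots> = ennreal (r * B * f x powr p) * ennreal (f x powr (r - p) / (p - r))"
      using rp fx nn_integral_powr_above[of "r - p - 1" "f x"] by (simp add: nn_integral_cmult)
    also have "\<dots> = ennreal (r * B * f x powr p * (f x powr (r - p) / (p - r)))"
      using r B rp by (intro ennreal_mult[symmetric]) auto
    also have "r * B * f x powr p * (f x powr (r - p) / (p - r)) = r * B / (p - r) * f x powr r"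
      using fx by (simp add: powr_diff)
    also have "ennreal \<dots> = ennreal (r * B / (p - r)) * ennreal (f x powr r)"
      using r B rp by (intro ennreal_mult) auto
    finally show ?thesis by simp
  qed
  have "(\<integral>\<^sup>+x. ennreal (F x powr r) \<partial>M) = (\<integral>\<^sup>+x. \<integral>\<^sup>+l. w l * indicator {l. l < F x} l \<partial>lborel \<partial>M)"
    by (simp add: 1)
  also have "\<dots> = (\<integral>\<^sup>+l. \<integral>\<^sup>+x. w l * indicator {l. l < F x} l \<partial>M \<partial>lborel)"
    unfolding indicator_def by (rule Fubini'[symmetric]) measurable
  also have "\<dots> = (\<integral>\<^sup>+l. w l * emeasure M {x\<in>space M. l < F x} \<partial>lborel)"
  proof (rule nn_integral_cong)
    fix l
    have "(\<integral>\<^sup>+x. w l * indicator {l. l < F x} l \<partial>M) = (\<integral>\<^sup>+x. w l * indicator {x\<in>space M. l < F x} x \<partial>M)"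
      by (intro nn_integral_cong) (auto simp: indicator_def)
    then show "(\<integral>\<^sup>+x. w l * indicator {l. l < F x} l \<partial>M) = w l * emeasure M {x\<in>space M. l < F x}"
      by (simp add: nn_integral_cmult)
  qed
  also have "\<dots> \<le> (\<integral>\<^sup>+l. (\<integral>\<^sup>+x. G1 x l \<partial>M) + (\<integral>\<^sup>+x. G2 x l \<partial>M) \<partial>lborel)"
  proof (rule nn_integral_mono)
    fix l :: real
    show "w l * emeasure M {x\<in>space M. l < F x} \<le> (\<integral>\<^sup>+x. G1 x l \<partial>M) + (\<integral>\<^sup>+x. G2 x l \<partial>M)"
    proof (cases "0 < l")
      case True
      have "(\<integral>\<^sup>+x. G1 x l \<partial>M) + (\<integral>\<^sup>+x. G2 x l \<partial>M) = w l * (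
       ennreal (A * l powr (-q)) * (\<integral>\<^sup>+x. ennreal (f x powr q) * indicator {x. l < f x} x \<partial>M) +
       ennreal (B * l powr (-p)) * (\<integral>\<^sup>+x. ennreal (f x powr p) * indicator {x. f x \<le> l} x \<partial>M))"
        unfolding G1_def G2_def sw by (simp add: nn_integral_cmult distrib_left)
      then show ?thesis using mult_left_mono[OF weak[OF True], of "w l"] by simp
    qed (simp add: w_def)
  qed
  also have "\<dots> = (\<integral>\<^sup>+l. \<integral>\<^sup>+x. G1 x l \<partial>M \<partial>lborel) + (\<integral>\<^sup>+l. \<integral>\<^sup>+x. G2 x l \<partial>M \<partial>lborel)"
    by (rule nn_integral_add) measurable
  also have "\<dots> = (\<integral>\<^sup>+x. \<integral>\<^sup>+l. G1 x l \<partial>lborel \<partial>M) + (\<integral>\<^sup>+x. \<integral>\<^sup>+l. G2 x l \<partial>lborel \<partial>M)"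
    by (simp add: Fubini'[OF mG1] Fubini'[OF mG2])
  also have "\<dots> \<le> (\<integral>\<^sup>+x. ennreal (r * A / (r - q)) * ennreal (f x powr r) \<partial>M)
      + (\<integral>\<^sup>+x. ennreal (r * B / (p - r)) * ennreal (f x powr r) \<partial>M)"
    by (intro add_mono nn_integral_mono) (simp_all add: G1x G2x)
  also have "\<dots> = (ennreal (r * A / (r - q)) + ennreal (r * B / (p - r))) * (\<integral>\<^sup>+x. ennreal (f x powr r) \<partial>M)"
    by (simp add: nn_integral_cmult distrib_right)
  also have "ennreal (r * A / (r - q)) + ennreal (r * B / (p - r)) = ennreal (r * (A / (r - q) + B / (p - r)))"
    using r A B qr rp by (subst ennreal_plus[symmetric]) (auto simp: field_simps)
  finally show ?thesis .
qed

lemma nn_integral_Lnorm: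
  assumes "f \<in> Lspace M t" "0 < t"
  shows "(\<integral>\<^sup>+x. ennreal (norm (f x) powr t) \<partial>M) = ennreal (Lnorm M t f powr t)"
  using assms by (simp add: Lnorm_powr nn_integral_eq_integral Lspace_integrable)

lemma nn_integral_le_of_Lnorm_le:
  assumes "f \<in> Lspace M t" "g \<in> Lspace M t" "0 < t" "0 \<le> C" "Lnorm M t f \<le> C * Lnorm M t g"
  shows "(\<integral>\<^sup>+x. ennreal (norm (f x) powr t) \<partial>M) \<le> ennreal (C powr t) * (\<integral>\<^sup>+x. ennreal (norm (g x) powr t) \<partial>M)"
proof -
  have "Lnorm M t f powr t \<le> (C * Lnorm M t g) powr t" using assms by (intro powr_mono2) auto
  then show ?thesis
    using assms by (simp add: nn_integral_Lnorm ennreal_mult[symmetric] powr_mult)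
qed

lemma Lnorm_le_of_nn_integral_le:
  assumes f [measurable]: "f \<in> borel_measurable M" and g: "g \<in> Lspace M t" and t: "0 < t" and D: "0 \<le> D"
    and le: "(\<integral>\<^sup>+x. ennreal (norm (f x) powr t) \<partial>M) \<le> ennreal D * (\<integral>\<^sup>+x. ennreal (norm (g x) powr t) \<partial>M)"
  shows "f \<in> Lspace M t" "Lnorm M t f \<le> D powr (1/t) * Lnorm M t g"
proof -
  have le': "(\<integral>\<^sup>+x. ennreal (norm (f x) powr t) \<partial>M) \<le> ennreal (D * Lnorm M t g powr t)"
    using le D by (simp add: nn_integral_Lnorm[OF g t] ennreal_mult)
  have "integrable M (\<lambda>x. norm (f x) powr t)"
    by (rule integrableI_bounded) (use le' in \<open>auto intro: le_less_trans\<close>)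
  then show fL: "f \<in> Lspace M t" by (simp add: Lspace_def)
  have "Lnorm M t f powr t \<le> D * Lnorm M t g powr t"
    using le' D by (simp add: nn_integral_Lnorm[OF fL t])
  then have "(Lnorm M t f powr t) powr (1/t) \<le> (D * Lnorm M t g powr t) powr (1/t)"
    using t by (intro powr_mono2) auto
  then show "Lnorm M t f \<le> D powr (1/t) * Lnorm M t g"
    using t D by (simp add: powr_mult powr_powr)
qed

text \<open>
  Marcinkiewicz interpolation with strong endpoint bounds. At height \<open>l\<close> split \<open>u\<close> into the part
  \<open>u1\<close> where \<open>l < norm (u x)\<close> and the rest \<open>u2\<close>. By subadditivity one of \<open>T u1\<close>, \<open>T u2\<close> exceeds
  \<open>l / 2\<close> wherever \<open>T u\<close> exceeds \<open>l\<close>, and Chebyshev's inequality with exponent \<open>q\<close> for the first and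
  \<open>p\<close> for the second gives the hypothesis of the weak-type lemma. Subadditivity is required only
  almost everywhere since \<open>T\<close> will be determined only up to null sets.
\<close>
lemma (in finite_measure) Marcinkiewicz:
  fixes T :: "('a \<Rightarrow> complex) \<Rightarrow> 'a \<Rightarrow> complex"
  assumes qr: "0 < q" "q < r" and rp: "r < p" and C: "0 \<le> C" and D: "0 \<le> D"
    and Tq: "\<And>u. u \<in> bdd_meas M \<Longrightarrow> T u \<in> Lspace M q \<and> Lnorm M q (T u) \<le> C * Lnorm M q u"
    and Tp: "\<And>u. u \<in> bdd_meas M \<Longrightarrow> T u \<in> Lspace M p \<and> Lnorm M p (T u) \<le> D * Lnorm M p u"
    and sub: "\<And>u v. u \<in> bdd_meas M \<Longrightarrow> v \<in> bdd_meas M \<Longrightarrow>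
       AE x in M. norm (T (\<lambda>x. u x + v x) x) \<le> norm (T u x) + norm (T v x)"
  obtains K where "0 \<le> K"
    "\<And>u. u \<in> bdd_meas M \<Longrightarrow> T u \<in> Lspace M r \<and> Lnorm M r (T u) \<le> K * Lnorm M r u"
proof -
  define A B where "A = (2 * C) powr q" and "B = (2 * D) powr p"
  define E where "E = r * (A / (r - q) + B / (p - r))"
  have E0: "0 \<le> E" using qr rp by (simp add: E_def A_def B_def)
  show ?thesis
  proof (rule that[of "E powr (1/r)"])
    fix u assume u: "u \<in> bdd_meas M"
    have Tm [measurable]: "T w \<in> borel_measurable M" if "w \<in> bdd_meas M" for w
      using Tq[OF that] by (auto intro: Lspace_measurable)
    note [measurable] = bdd_meas_measurable[OF u]
    obtain b where b: "\<And>x. norm (u x) \<le> b" using u by (auto simp: bdd_meas_def)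
    have "(\<integral>\<^sup>+x. ennreal (norm (T u x) powr r) \<partial>M) \<le> ennreal E * (\<integral>\<^sup>+x. ennreal (norm (u x) powr r) \<partial>M)"
      unfolding E_def
    proof (rule nn_integral_powr_le_of_weak_type[OF _ _ _ _ _ _ qr rp])
      fix l :: real assume l: "0 < l"
      define u1 u2 where "u1 = (\<lambda>x. if l < norm (u x) then u x else 0)"
        and "u2 = (\<lambda>x. if norm (u x) \<le> l then u x else 0)"
      have u1: "u1 \<in> bdd_meas M" unfolding u1_def by (rule bdd_meas_restrict[of _ _ _ b]) (use b in auto)
      have u2: "u2 \<in> bdd_meas M" unfolding u2_def by (rule bdd_meas_restrict[of _ _ _ b]) (use b in auto)
      note [measurable] = Tm[OF u] Tm[OF u1] Tm[OF u2]
      have "u = (\<lambda>x. u1 x + u2 x)" by (auto simp: u1_def u2_def)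
      then have tri: "AE x in M. norm (T u x) \<le> norm (T u1 x) + norm (T u2 x)"
        using sub[OF u1 u2] by simp
      have AB: "A * l powr (-q) = (2/l) powr q * C powr q" "B * l powr (-p) = (2/l) powr p * D powr p"
        by (simp_all add: A_def B_def powr_mult powr_divide powr_minus field_simps)
      have "emeasure M {x\<in>space M. l < norm (T u x)} = (\<integral>\<^sup>+x. indicator {x\<in>space M. l < norm (T u x)} x \<partial>M)"
        by (rule nn_integral_indicator[symmetric]) measurable
      also have "\<dots> \<le> (\<integral>\<^sup>+x. ennreal ((2/l) powr q) * ennreal (norm (T u1 x) powr q)
         + ennreal ((2/l) powr p) * ennreal (norm (T u2 x) powr p) \<partial>M)"
      proof (rule nn_integral_mono_AE)
        show "AE x in M. indicator {x\<in>space M. l < norm (T u x)} x \<le> ennreal ((2/l) powr q) * ennreal (norm (T u1 x) powr q)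
         + ennreal ((2/l) powr p) * ennreal (norm (T u2 x) powr p)"
          using tri
        proof eventually_elim
          case (elim x)
          have big: "1 \<le> ennreal ((2/l) powr t) * ennreal (a powr t)" if "l / 2 < a" "0 < t" for a t
          proof -
            have "1 powr t \<le> (2 / l * a) powr t" using that l by (intro powr_mono2) (auto simp: field_simps)
            also have "\<dots> = (2/l) powr t * a powr t" by (rule powr_mult)
            finally show ?thesis by (simp add: ennreal_mult[symmetric])
          qed
          show ?case
          proof (cases "l < norm (T u x)")
            case True
            then consider "l / 2 < norm (T u1 x)" | "l / 2 < norm (T u2 x)" using elim by linarith
            then have "1 \<le> ennreal ((2/l) powr q) * ennreal (norm (T u1 x) powr q)
              + ennreal ((2/l) powr p) * ennreal (norm (T u2 x) powr p)"
            proof cases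
              case 1
              from add_increasing2[OF _ big[OF 1 qr(1)]] show ?thesis by simp
            next
              case 2
              have "0 < p" using qr rp by simp
              from add_increasing[OF _ big[OF 2 this]] show ?thesis by simp
            qed
            then show ?thesis by (auto simp: indicator_def)
          qed (simp add: indicator_def)
        qed
      qed
      also have "\<dots> = ennreal ((2/l) powr q) * (\<integral>\<^sup>+x. ennreal (norm (T u1 x) powr q) \<partial>M)
         + ennreal ((2/l) powr p) * (\<integral>\<^sup>+x. ennreal (norm (T u2 x) powr p) \<partial>M)"
        by (simp add: nn_integral_add nn_integral_cmult)
      also have "\<dots> \<le> ennreal ((2/l) powr q) * (ennreal (C powr q) * (\<integral>\<^sup>+x. ennreal (norm (u1 x) powr q) \<partial>M))
         + ennreal ((2/l) powr p) * (ennreal (D powr p) * (\<integral>\<^sup>+x. ennreal (norm (u2 x) powr p) \<partial>M))"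
      proof (intro add_mono mult_left_mono)
        show "(\<integral>\<^sup>+x. ennreal (norm (T u1 x) powr q) \<partial>M) \<le> ennreal (C powr q) * (\<integral>\<^sup>+x. ennreal (norm (u1 x) powr q) \<partial>M)"
          using Tq[OF u1] bdd_meas_Lspace[OF u1, of q] qr C by (intro nn_integral_le_of_Lnorm_le) auto
        show "(\<integral>\<^sup>+x. ennreal (norm (T u2 x) powr p) \<partial>M) \<le> ennreal (D powr p) * (\<integral>\<^sup>+x. ennreal (norm (u2 x) powr p) \<partial>M)"
          using Tp[OF u2] bdd_meas_Lspace[OF u2, of p] qr rp D by (intro nn_integral_le_of_Lnorm_le) auto
      qed auto
      also have "(\<integral>\<^sup>+x. ennreal (norm (u1 x) powr q) \<partial>M) = (\<integral>\<^sup>+x. ennreal (norm (u x) powr q) * indicator {x. l < norm (u x)} x \<partial>M)"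
        by (intro nn_integral_cong) (auto simp: u1_def indicator_def)
      also have "(\<integral>\<^sup>+x. ennreal (norm (u2 x) powr p) \<partial>M) = (\<integral>\<^sup>+x. ennreal (norm (u x) powr p) * indicator {x. norm (u x) \<le> l} x \<partial>M)"
        by (intro nn_integral_cong) (auto simp: u2_def indicator_def)
      finally show "emeasure M {x\<in>space M. l < norm (T u x)} \<le>
         ennreal (A * l powr (-q)) * (\<integral>\<^sup>+x. ennreal (norm (u x) powr q) * indicator {x. l < norm (u x)} x \<partial>M) +
         ennreal (B * l powr (-p)) * (\<integral>\<^sup>+x. ennreal (norm (u x) powr p) * indicator {x. norm (u x) \<le> l} x \<partial>M)"
        by (simp add: AB ennreal_mult mult.assoc)
    qed (use Tm[OF u] in \<open>auto simp: A_def B_def\<close>)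
    from Lnorm_le_of_nn_integral_le[OF Tm[OF u] bdd_meas_Lspace[OF u] _ E0 this]
    show "T u \<in> Lspace M r \<and> Lnorm M r (T u) \<le> E powr (1/r) * Lnorm M r u"
      using qr by simp
  qed simp
qed

section \<open>Interpolating the surjectivity of the pairing\<close>

definition bdd_functional ::
    "'a measure \<Rightarrow> ('a \<Rightarrow> complex) set \<Rightarrow> real \<Rightarrow> (('a \<Rightarrow> complex) \<Rightarrow> complex) \<Rightarrow> bool" where
  "bdd_functional M V r L \<longleftrightarrow>
     (\<forall>f\<in>V \<inter> Lspace M r. \<forall>g\<in>V \<inter> Lspace M r. L (\<lambda>x. f x + g x) = L f + L g) \<and>
     (\<forall>c. \<forall>f\<in>V \<inter> Lspace M r. L (\<lambda>x. c * f x) = c * L f) \<and>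
     (\<exists>C. \<forall>f\<in>V \<inter> Lspace M r. norm (L f) \<le> C * Lnorm M r f)"

text \<open>
  Every bounded functional on the \<open>L\<^sup>r\<close> part of \<open>V\<close> is given by pairing with an element of its
  \<open>L\<^sup>s\<close> part: the surjectivity of \<open>\<Phi>\<^sub>r\<close> for a general function space \<open>V\<close>.
\<close>
definition pairing_onto :: "'a measure \<Rightarrow> ('a \<Rightarrow> complex) set \<Rightarrow> real \<Rightarrow> real \<Rightarrow> bool" where
  "pairing_onto M V r s \<longleftrightarrow>
     (\<forall>L. bdd_functional M V r L \<longrightarrow>
        (\<exists>g\<in>V \<inter> Lspace M s. \<forall>f\<in>V \<inter> Lspace M r. L f = (\<integral>x. f x * cnj (g x) \<partial>M)))"

lemma bdd_functional_pairing:
  assumes g: "g \<in> Lspace M s" and r: "1 < r" and rs: "1/r + 1/s = 1"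
  shows "bdd_functional M V r (\<lambda>f. \<integral>x. f x * cnj (g x) \<partial>M)"
  unfolding bdd_functional_def
proof (intro conjI ballI allI exI)
  fix f h assume "f \<in> V \<inter> Lspace M r" "h \<in> V \<inter> Lspace M r"
  then show "(\<integral>x. (f x + h x) * cnj (g x) \<partial>M) = (\<integral>x. f x * cnj (g x) \<partial>M) + (\<integral>x. h x * cnj (g x) \<partial>M)"
    using integrable_Holder_cnj[OF _ g r rs] by (simp add: distrib_right)
next
  fix c f
  show "(\<integral>x. (c * f x) * cnj (g x) \<partial>M) = c * (\<integral>x. f x * cnj (g x) \<partial>M)"
    by (simp add: mult.assoc)
next
  fix f assume "f \<in> V \<inter> Lspace M r"
  then show "norm (\<integral>x. f x * cnj (g x) \<partial>M) \<le> Lnorm M s g * Lnorm M r f"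
    using norm_integral_Holder_cnj[OF _ g r rs, of f] by (simp add: mult.commute)
qed

text \<open>
  The setting of the interpolation argument, with the Bergman spaces replaced by the \<open>L\<^sup>r\<close> parts of
  one linear space of functions.
\<close>
locale dual_exponents = finite_measure M for M :: "'a measure" +
  fixes V :: "('a \<Rightarrow> complex) set" and p q :: real
  assumes V_add: "f \<in> V \<Longrightarrow> g \<in> V \<Longrightarrow> (\<lambda>x. f x + g x) \<in> V"
    and V_cmult: "f \<in> V \<Longrightarrow> (\<lambda>x. c * f x) \<in> V"
    and q: "1 < q" and qp: "q \<le> p" and conj_qp: "1/q + 1/p = 1"
    and onto_p: "pairing_onto M V p q" and onto_q: "pairing_onto M V q p"
begin

lemma p: "1 < p" using q qp by simp

lemma conj_pq: "1/p + 1/q = 1" using conj_qp by simp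

lemma V_diff: "f \<in> V \<Longrightarrow> g \<in> V \<Longrightarrow> (\<lambda>x. f x - g x) \<in> V"
  using V_add[of f "\<lambda>x. (-1) * g x"] V_cmult[of g "-1"] by simp

text \<open>
  In the application this is the Bergman projection. It is characterised by having the same pairing
  as \<open>u\<close> with all elements of \<open>V\<close> in the larger space \<open>Lspace M q\<close>; such a function exists
  in \<open>V\<close> and \<open>Lspace M p\<close> by the surjectivity for the exponent \<open>q\<close>.
  The solution is unique only up to null sets, hence the choice operator.
\<close>
definition proj :: "('a \<Rightarrow> complex) \<Rightarrow> 'a \<Rightarrow> complex" where
  "proj u = (SOME h. h \<in> V \<inter> Lspace M p \<and>
     (\<forall>g\<in>V \<inter> Lspace M q. (\<integral>x. g x * cnj (h x) \<partial>M) = (\<integral>x. g x * cnj (u x) \<partial>M)))"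

lemma proj:
  assumes u: "u \<in> Lspace M p"
  shows proj_V: "proj u \<in> V" and proj_Lp: "proj u \<in> Lspace M p"
    and proj_repr: "g \<in> V \<Longrightarrow> g \<in> Lspace M q \<Longrightarrow>
        (\<integral>x. g x * cnj (proj u x) \<partial>M) = (\<integral>x. g x * cnj (u x) \<partial>M)"
proof -
  have "\<exists>h. h \<in> V \<inter> Lspace M p \<and>
     (\<forall>g\<in>V \<inter> Lspace M q. (\<integral>x. g x * cnj (h x) \<partial>M) = (\<integral>x. g x * cnj (u x) \<partial>M))"
  proof -
    obtain h where h: "h \<in> V \<inter> Lspace M p"
        "\<And>g. g \<in> V \<inter> Lspace M q \<Longrightarrow> (\<integral>x. g x * cnj (u x) \<partial>M) = (\<integral>x. g x * cnj (h x) \<partial>M)"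
      using onto_q[unfolded pairing_onto_def, rule_format, OF bdd_functional_pairing[OF u q conj_qp]] by blast
    show ?thesis by (rule exI[of _ h]) (use h in auto)
  qed
  from someI_ex[OF this]
  show "proj u \<in> V" "proj u \<in> Lspace M p" "g \<in> V \<Longrightarrow> g \<in> Lspace M q \<Longrightarrow>
        (\<integral>x. g x * cnj (proj u x) \<partial>M) = (\<integral>x. g x * cnj (u x) \<partial>M)"
    unfolding proj_def[symmetric] by auto
qed

lemma Lp_imp_Lq: "f \<in> Lspace M p \<Longrightarrow> f \<in> Lspace M q"
  using Lspace_antimono[of f p q] q qp by simp

lemma bdd_Lp: "u \<in> bdd_meas M \<Longrightarrow> u \<in> Lspace M p"
  using bdd_meas_Lspace[of u p] p by simp

text \<open>
  Both sides equal the pairing of \<open>proj u\<close> with \<open>proj v\<close>, since each projection lies in \<open>V\<close> and in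
  \<open>Lspace M p\<close>, hence in \<open>Lspace M q\<close>, and may be used as a test function for the other.
\<close>
lemma proj_symmetric:
  assumes u: "u \<in> Lspace M p" and v: "v \<in> Lspace M p"
  shows "(\<integral>x. proj u x * cnj (v x) \<partial>M) = (\<integral>x. u x * cnj (proj v x) \<partial>M)"
proof -
  have "(\<integral>x. proj u x * cnj (v x) \<partial>M) = (\<integral>x. proj u x * cnj (proj v x) \<partial>M)"
    using proj[OF u] by (intro proj_repr[OF v, symmetric] Lp_imp_Lq)
  also have "\<dots> = cnj (\<integral>x. proj v x * cnj (proj u x) \<partial>M)" by (rule integral_pairing_cnj)
  also have "(\<integral>x. proj v x * cnj (proj u x) \<partial>M) = (\<integral>x. proj v x * cnj (u x) \<partial>M)"
    using proj[OF v] by (intro proj_repr[OF u] Lp_imp_Lq)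
  also have "cnj \<dots> = (\<integral>x. u x * cnj (proj v x) \<partial>M)" by (rule integral_pairing_cnj[symmetric])
  finally show ?thesis .
qed

text \<open>
  Since \<open>q \<le> p\<close>, the function \<open>h\<close> can be tested against itself.
\<close>
lemma AE_eq_0_if_orthogonal:
  assumes h: "h \<in> V" "h \<in> Lspace M p"
    and orth: "\<And>g. g \<in> V \<Longrightarrow> g \<in> Lspace M q \<Longrightarrow> (\<integral>x. g x * cnj (h x) \<partial>M) = 0"
  shows "AE x in M. h x = 0"
proof -
  have hq: "h \<in> Lspace M q" by (rule Lp_imp_Lq[OF h(2)])
  have eq: "h x * cnj (h x) = complex_of_real ((norm (h x))\<^sup>2)" for x
    by (rule complex_norm_square[symmetric])
  have int: "integrable M (\<lambda>x. (norm (h x))\<^sup>2)"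
    using integrable_norm[OF integrable_Holder_cnj[OF h(2) hq p conj_pq]]
    by (simp add: norm_mult power2_eq_square)
  have "complex_of_real (\<integral>x. (norm (h x))\<^sup>2 \<partial>M) = 0"
    using orth[OF h(1) hq] unfolding eq integral_complex_of_real .
  then have "AE x in M. (norm (h x))\<^sup>2 = 0"
    using int by (simp add: integral_nonneg_eq_0_iff_AE)
  then show ?thesis by simp
qed

lemma proj_add_AE:
  assumes u: "u \<in> Lspace M p" and v: "v \<in> Lspace M p"
  shows "AE x in M. proj (\<lambda>x. u x + v x) x = proj u x + proj v x"
proof -
  define w where "w = (\<lambda>x. u x + v x)"
  have w: "w \<in> Lspace M p" unfolding w_def using u v p by (intro Lspace_add) auto
  define h where "h = (\<lambda>x. proj w x - (proj u x + proj v x))"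
  have hV: "h \<in> V" unfolding h_def using proj u v w by (intro V_diff V_add) auto
  have hL: "h \<in> Lspace M p"
    unfolding h_def using proj_Lp[OF u] proj_Lp[OF v] proj_Lp[OF w] p by (intro Lspace_diff Lspace_add) auto
  have "AE x in M. h x = 0"
  proof (rule AE_eq_0_if_orthogonal[OF hV hL])
    fix g assume g: "g \<in> V" "g \<in> Lspace M q"
    note int = integrable_Holder_cnj[OF g(2) _ q conj_qp]
    have "(\<integral>x. g x * cnj (h x) \<partial>M) = (\<integral>x. g x * cnj (proj w x) \<partial>M)
       - ((\<integral>x. g x * cnj (proj u x) \<partial>M) + (\<integral>x. g x * cnj (proj v x) \<partial>M))"
      unfolding h_def using int[OF proj_Lp[OF u]] int[OF proj_Lp[OF v]] int[OF proj_Lp[OF w]]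
      by (simp add: algebra_simps)
    also have "\<dots> = (\<integral>x. g x * cnj (w x) \<partial>M) - ((\<integral>x. g x * cnj (u x) \<partial>M) + (\<integral>x. g x * cnj (v x) \<partial>M))"
      using g by (simp add: proj_repr u v w)
    also have "\<dots> = 0"
      unfolding w_def using int[OF u] int[OF v] by (simp add: algebra_simps)
    finally show "(\<integral>x. g x * cnj (h x) \<partial>M) = 0" .
  qed
  then show ?thesis by (simp add: h_def w_def)
qed

text \<open>
  Pairing \<open>u\<close> with \<open>proj v\<close> is, by symmetry, pairing \<open>proj u\<close> with \<open>v\<close>; for fixed \<open>u\<close> in
  \<open>Lspace M p\<close> this stays bounded by the norm of \<open>proj u\<close> while \<open>v\<close> runs through the unit ball of
  \<open>L\<^sup>q\<close>. The uniform boundedness principle turns this into a bound for the norms of \<open>proj v\<close>.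
\<close>
lemma proj_bounded_q:
  obtains C where "0 \<le> C" "\<And>v. v \<in> bdd_meas M \<Longrightarrow> Lnorm M q (proj v) \<le> C * Lnorm M q v"
proof -
  \<comment> \<open>The factor \<open>c\<close> stays outside \<open>proj\<close>, which is homogeneous only almost everywhere; letting it be
    arbitrary when \<open>Lnorm M q v = 0\<close> covers that case too.\<close>
  define G where "G = {\<lambda>x. complex_of_real c * proj v x | c v. v \<in> bdd_meas M \<and> 0 \<le> c \<and> c * Lnorm M q v \<le> 1}"
  have "\<exists>C. \<forall>g\<in>G. Lnorm M q g \<le> C"
  proof (rule uniform_boundedness_Lspace[OF q conj_qp])
    show "G \<subseteq> Lspace M q"
      unfolding G_def using Lspace_cmult[OF Lp_imp_Lq[OF proj_Lp[OF bdd_Lp]]] by auto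
    fix u assume u: "u \<in> Lspace M p"
    have "norm (\<integral>x. u x * cnj (complex_of_real c * proj v x) \<partial>M) \<le> Lnorm M p (proj u)"
      if v: "v \<in> bdd_meas M" and c: "0 \<le> c" "c * Lnorm M q v \<le> 1" for c v
    proof -
      have "(\<integral>x. u x * cnj (complex_of_real c * proj v x) \<partial>M) = c * (\<integral>x. u x * cnj (proj v x) \<partial>M)"
        by (simp add: mult.left_commute)
      also have "(\<integral>x. u x * cnj (proj v x) \<partial>M) = (\<integral>x. proj u x * cnj (v x) \<partial>M)"
        by (rule proj_symmetric[OF u bdd_Lp[OF v], symmetric])
      finally have "norm (\<integral>x. u x * cnj (complex_of_real c * proj v x) \<partial>M) = c * norm (\<integral>x. proj u x * cnj (v x) \<partial>M)"
        using c by (simp add: norm_mult)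
      also have "\<dots> \<le> c * (Lnorm M p (proj u) * Lnorm M q v)"
        by (intro mult_left_mono norm_integral_Holder_cnj[OF proj_Lp[OF u] Lp_imp_Lq[OF bdd_Lp[OF v]] p conj_pq] c)
      also have "\<dots> = Lnorm M p (proj u) * (c * Lnorm M q v)" by simp
      also have "\<dots> \<le> Lnorm M p (proj u)" using mult_left_mono[OF c(2), of "Lnorm M p (proj u)"] by simp
      finally show ?thesis .
    qed
    then show "\<exists>K. \<forall>g\<in>G. norm (\<integral>x. u x * cnj (g x) \<partial>M) \<le> K"
      unfolding G_def by (intro exI[of _ "Lnorm M p (proj u)"]) auto
  qed
  then obtain C where C: "\<And>g. g \<in> G \<Longrightarrow> Lnorm M q g \<le> C" by blast
  have CG: "c * Lnorm M q (proj v) \<le> C" if "v \<in> bdd_meas M" "0 \<le> c" "c * Lnorm M q v \<le> 1" for c v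
  proof -
    have "(\<lambda>x. complex_of_real c * proj v x) \<in> G" using that unfolding G_def by blast
    from C[OF this] show ?thesis using that q by (simp add: Lnorm_cmult)
  qed
  show ?thesis
  proof (rule that[of "max C 0"])
    fix v assume v: "v \<in> bdd_meas M"
    show "Lnorm M q (proj v) \<le> max C 0 * Lnorm M q v"
    proof (cases "Lnorm M q v = 0")
      case True
      have "Lnorm M q (proj v) = 0"
      proof (rule ccontr)
        assume n: "Lnorm M q (proj v) \<noteq> 0"
        then have "0 < Lnorm M q (proj v)" by (simp add: less_le)
        then show False
          using CG[OF v, of "(max C 0 + 1) / Lnorm M q (proj v)"] True by simp
      qed
      then show ?thesis by simp
    next
      case False
      then have "0 < Lnorm M q v" by (simp add: less_le)
      then have "Lnorm M q (proj v) \<le> C * Lnorm M q v"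
        using CG[OF v, of "1 / Lnorm M q v"] by (simp add: pos_divide_le_eq)
      also have "\<dots> \<le> max C 0 * Lnorm M q v" by (intro mult_right_mono) auto
      finally show ?thesis .
    qed
  qed simp
qed

text \<open>
  The bound on \<open>L\<^sup>q\<close> dualises to the conjugate exponent by symmetry.
\<close>
lemma proj_bounded_p:
  obtains C where "0 \<le> C" "\<And>v. v \<in> bdd_meas M \<Longrightarrow> Lnorm M p (proj v) \<le> C * Lnorm M p v"
proof -
  obtain C where C: "0 \<le> C" "\<And>v. v \<in> bdd_meas M \<Longrightarrow> Lnorm M q (proj v) \<le> C * Lnorm M q v"
    by (rule proj_bounded_q) blast
  show ?thesis
  proof (rule that[OF C(1)])
    fix v assume v: "v \<in> bdd_meas M"
    have "proj v \<in> Lspace M p \<and> Lnorm M p (proj v) \<le> C * Lnorm M p v"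
    proof (rule converse_Holder[OF Lspace_measurable[OF proj_Lp[OF bdd_Lp[OF v]]] p conj_pq])
      fix u assume u: "u \<in> bdd_meas M"
      have "norm (\<integral>x. proj v x * cnj (u x) \<partial>M) = norm (\<integral>x. v x * cnj (proj u x) \<partial>M)"
        using proj_symmetric[OF bdd_Lp[OF v] bdd_Lp[OF u]] by simp
      also have "\<dots> \<le> Lnorm M p v * Lnorm M q (proj u)"
        by (rule norm_integral_Holder_cnj[OF bdd_Lp[OF v] Lp_imp_Lq[OF proj_Lp[OF bdd_Lp[OF u]]] p conj_pq])
      also have "\<dots> \<le> Lnorm M p v * (C * Lnorm M q u)" by (intro mult_left_mono C u) simp
      finally show "norm (\<integral>x. proj v x * cnj (u x) \<partial>M) \<le> C * Lnorm M p v * Lnorm M q u"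
        by (simp add: mult_ac)
    qed (use C in simp)
    then show "Lnorm M p (proj v) \<le> C * Lnorm M p v" by simp
  qed
qed

lemma proj_bounded:
  assumes "q < r" "r < p"
  obtains C where "0 \<le> C" "\<And>v. v \<in> bdd_meas M \<Longrightarrow> Lnorm M r (proj v) \<le> C * Lnorm M r v"
proof -
  obtain C where C: "0 \<le> C" "\<And>v. v \<in> bdd_meas M \<Longrightarrow> Lnorm M q (proj v) \<le> C * Lnorm M q v"
    by (rule proj_bounded_q) blast
  obtain D where D: "0 \<le> D" "\<And>v. v \<in> bdd_meas M \<Longrightarrow> Lnorm M p (proj v) \<le> D * Lnorm M p v"
    by (rule proj_bounded_p) blast
  have "\<exists>K\<ge>0. \<forall>u\<in>bdd_meas M. proj u \<in> Lspace M r \<and> Lnorm M r (proj u) \<le> K * Lnorm M r u"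
  proof (rule Marcinkiewicz[where T=proj and q=q and p=p and r=r and C=C and D=D])
    fix u v assume u: "u \<in> bdd_meas M" and v: "v \<in> bdd_meas M"
    show "AE x in M. norm (proj (\<lambda>x. u x + v x) x) \<le> norm (proj u x) + norm (proj v x)"
      using proj_add_AE[OF bdd_Lp[OF u] bdd_Lp[OF v]] by eventually_elim (simp add: norm_triangle_ineq)
  qed (use q assms C D proj_Lp bdd_Lp Lp_imp_Lq in auto)
  then show ?thesis using that by blast
qed

text \<open>
  Restricting \<open>L\<close> to the smaller space of exponent \<open>p\<close> yields a representing function \<open>h\<close>, a priori
  only in \<open>Lspace M q\<close>. For bounded \<open>u\<close> the pairing of \<open>u\<close> with \<open>h\<close> is \<open>L (proj u)\<close>, which the \<open>L\<^sup>r\<close> bound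
  of \<open>proj\<close> controls by the norm of \<open>u\<close>; so \<open>h\<close> belongs to \<open>Lspace M s\<close>. It remains to extend the
  representation from \<open>p\<close> to \<open>r\<close>, for which the projections of the truncations \<open>u n\<close> of a given \<open>g\<close>
  serve as approximants.
\<close>
theorem pairing_onto_between:
  assumes r: "q < r" "r < p" and rs: "1/r + 1/s = 1"
  shows "pairing_onto M V r s"
  unfolding pairing_onto_def
proof (intro allI impI)
  fix L assume L: "bdd_functional M V r L"
  have r1: "1 < r" using q r by simp
  have s: "1 < s" by (rule conjugate_exponent[OF r1 rs])
  have sr: "1/s + 1/r = 1" using rs by simp
  \<comment> \<open>The interval from \<open>q\<close> to \<open>p\<close> is stable under conjugation, so \<open>proj\<close> is bounded on \<open>L\<^sup>s\<close> as well.\<close>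
  have sb: "q < s" "s < p"
  proof -
    have "1/p < 1/r" "1/r < 1/q" using q r by (auto simp: frac_less2)
    then have "1/s < 1/q" "1/p < 1/s" using rs conj_pq by linarith+
    then show "q < s" "s < p" using q s p by (auto simp: field_simps)
  qed
  have rq: "f \<in> Lspace M q" if "f \<in> Lspace M r" for f using Lspace_antimono[OF that] q r by simp
  have pr: "f \<in> Lspace M r" if "f \<in> Lspace M p" for f using Lspace_antimono[OF that] q r by simp
  have ps: "f \<in> Lspace M s" if "f \<in> Lspace M p" for f using Lspace_antimono[OF that] q sb by simp
  have Ladd: "L (\<lambda>x. f x + g x) = L f + L g" if "f \<in> V" "f \<in> Lspace M r" "g \<in> V" "g \<in> Lspace M r" for f g
    using L that unfolding bdd_functional_def by blast
  have Lcm: "L (\<lambda>x. c * f x) = c * L f" if "f \<in> V" "f \<in> Lspace M r" for c f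
    using L that unfolding bdd_functional_def by blast
  obtain B0 where B0: "\<And>f. f \<in> V \<Longrightarrow> f \<in> Lspace M r \<Longrightarrow> norm (L f) \<le> B0 * Lnorm M r f"
    using L unfolding bdd_functional_def by blast
  define B where "B = max B0 0"
  have B: "norm (L f) \<le> B * Lnorm M r f" if "f \<in> V" "f \<in> Lspace M r" for f
    using B0[OF that] mult_right_mono[of B0 B "Lnorm M r f"] by (simp add: B_def)
  have B00: "0 \<le> B" by (simp add: B_def)
  obtain C where C: "0 \<le> C" "\<And>v. v \<in> bdd_meas M \<Longrightarrow> Lnorm M r (proj v) \<le> C * Lnorm M r v"
    by (rule proj_bounded[OF r]) blast
  obtain D where D: "0 \<le> D" "\<And>v. v \<in> bdd_meas M \<Longrightarrow> Lnorm M s (proj v) \<le> D * Lnorm M s v"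
    by (rule proj_bounded[OF sb]) blast

  have "bdd_functional M V p L"
  proof -
    obtain E where E: "0 \<le> E" "\<And>f. f \<in> Lspace M p \<Longrightarrow> Lnorm M r f \<le> E * Lnorm M p f"
      by (rule Lnorm_embedding[of r p]) (use r r1 in auto)
    have "norm (L f) \<le> B * E * Lnorm M p f" if "f \<in> V \<inter> Lspace M p" for f
      using order_trans[OF B[of f] mult_left_mono[OF E(2)[of f] B00]] that pr by (simp add: mult.assoc)
    then show ?thesis unfolding bdd_functional_def using Ladd Lcm pr by blast
  qed
  then obtain h where h: "h \<in> V" "h \<in> Lspace M q"
      and Lh: "\<And>f. f \<in> V \<Longrightarrow> f \<in> Lspace M p \<Longrightarrow> L f = (\<integral>x. f x * cnj (h x) \<partial>M)"
    using onto_p unfolding pairing_onto_def by blast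

  have uh: "(\<integral>x. u x * cnj (h x) \<partial>M) = L (proj u)" if u: "u \<in> bdd_meas M" for u
  proof -
    note uL = bdd_Lp[OF u]
    have "(\<integral>x. u x * cnj (h x) \<partial>M) = cnj (\<integral>x. h x * cnj (u x) \<partial>M)" by (rule integral_pairing_cnj)
    also have "\<dots> = cnj (\<integral>x. h x * cnj (proj u x) \<partial>M)" using proj_repr[OF uL h] by simp
    also have "\<dots> = (\<integral>x. proj u x * cnj (h x) \<partial>M)" by (rule integral_pairing_cnj[symmetric])
    also have "\<dots> = L (proj u)" by (rule Lh[OF proj_V[OF uL] proj_Lp[OF uL], symmetric])
    finally show ?thesis .
  qed
  have hs: "h \<in> Lspace M s \<and> Lnorm M s h \<le> B * C"
  proof (rule converse_Holder[OF Lspace_measurable[OF h(2)] s sr])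
    fix u assume u: "u \<in> bdd_meas M"
    note uL = bdd_Lp[OF u]
    have "norm (\<integral>x. h x * cnj (u x) \<partial>M) = norm (L (proj u))"
      unfolding uh[OF u, symmetric] by (subst integral_pairing_cnj) simp
    also have "\<dots> \<le> B * Lnorm M r (proj u)" by (rule B[OF proj_V[OF uL] pr[OF proj_Lp[OF uL]]])
    also have "\<dots> \<le> B * (C * Lnorm M r u)" by (intro mult_left_mono C u B00)
    finally show "norm (\<integral>x. h x * cnj (u x) \<partial>M) \<le> B * C * Lnorm M r u" by (simp add: mult.assoc)
  qed (use B00 C in simp)

  show "\<exists>g\<in>V \<inter> Lspace M s. \<forall>f\<in>V \<inter> Lspace M r. L f = (\<integral>x. f x * cnj (g x) \<partial>M)"
  proof (intro bexI[of _ h] ballI)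
    fix g assume "g \<in> V \<inter> Lspace M r"
    then have gV: "g \<in> V" and gr: "g \<in> Lspace M r" by auto
    define u where "u = (\<lambda>(n::nat) x. if norm (g x) \<le> real n then g x else 0)"
    define e where "e = (\<lambda>n. Lnorm M r (\<lambda>x. g x - u n x))"
    have e: "e \<longlonglongrightarrow> 0" unfolding e_def u_def using truncation_tendsto[OF gr] r1 by simp
    have u: "u n \<in> bdd_meas M" for n
      unfolding u_def using Lspace_measurable[OF gr] by (intro bdd_meas_restrict[where B="real n"]) auto
    have dr: "(\<lambda>x. g x - u n x) \<in> Lspace M r" for n
      using Lspace_diff[OF gr pr[OF bdd_Lp[OF u]]] r1 by simp
    have key: "norm (L g - (\<integral>x. g x * cnj (h x) \<partial>M)) \<le> (B * D + Lnorm M s h) * e n" for n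
    proof -
      note un = bdd_Lp[OF u[of n]]
      note P = proj_V[OF un] proj_Lp[OF un]
      define k where "k = (\<lambda>x. g x - proj (u n) x)"
      have kV: "k \<in> V" and kr: "k \<in> Lspace M r"
        unfolding k_def using gV P V_diff Lspace_diff[OF gr pr[OF P(2)]] r1 by auto
      \<comment> \<open>\<open>proj\<close> fixes \<open>g\<close> in the weak sense, so \<open>k\<close> is the projection of \<open>g - u n\<close>; since that function
        is unbounded, the estimate is carried out on the other side of the pairing, where
        \<open>proj v\<close> with \<open>v\<close> bounded appears and the \<open>L\<^sup>s\<close> bound applies.\<close>
      have "k \<in> Lspace M r \<and> Lnorm M r k \<le> D * e n"
      proof (rule converse_Holder[OF Lspace_measurable[OF kr] r1 rs])
        fix v assume v: "v \<in> bdd_meas M"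
        note vL = bdd_Lp[OF v]
        have gi: "integrable M (\<lambda>x. f x * cnj (proj v x))" if "f \<in> Lspace M r" for f
          by (rule integrable_Holder_cnj[OF that ps[OF proj_Lp[OF vL]] r1 rs])
        have "(\<integral>x. k x * cnj (v x) \<partial>M) = (\<integral>x. k x * cnj (proj v x) \<partial>M)"
          by (rule proj_repr[OF vL kV rq[OF kr], symmetric])
        also have "\<dots> = (\<integral>x. g x * cnj (proj v x) \<partial>M) - (\<integral>x. proj (u n) x * cnj (proj v x) \<partial>M)"
          unfolding k_def using gi[OF gr] gi[OF pr[OF P(2)]] by (simp add: left_diff_distrib)
        also have "(\<integral>x. proj (u n) x * cnj (proj v x) \<partial>M) = (\<integral>x. proj (u n) x * cnj (v x) \<partial>M)"
          by (rule proj_repr[OF vL P(1) Lp_imp_Lq[OF P(2)]])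
        also have "\<dots> = (\<integral>x. u n x * cnj (proj v x) \<partial>M)" by (rule proj_symmetric[OF un vL])
        also have "(\<integral>x. g x * cnj (proj v x) \<partial>M) - \<dots> = (\<integral>x. (g x - u n x) * cnj (proj v x) \<partial>M)"
          using gi[OF gr] gi[OF pr[OF un]] by (simp add: left_diff_distrib)
        finally have "norm (\<integral>x. k x * cnj (v x) \<partial>M) \<le> e n * Lnorm M s (proj v)"
          unfolding e_def using norm_integral_Holder_cnj[OF dr ps[OF proj_Lp[OF vL]] r1 rs] by simp
        also have "\<dots> \<le> e n * (D * Lnorm M s v)" by (intro mult_left_mono D v) (simp add: e_def)
        finally show "norm (\<integral>x. k x * cnj (v x) \<partial>M) \<le> D * e n * Lnorm M s v" by (simp add: mult_ac)
      qed (use D in \<open>simp add: e_def\<close>)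
      then have Lk: "norm (L k) \<le> B * (D * e n)"
        using order_trans[OF B[OF kV kr] mult_left_mono[OF _ B00]] by blast
      have "g = (\<lambda>x. k x + proj (u n) x)" by (simp add: k_def)
      then have "L g = L k + L (proj (u n))" using Ladd[OF kV kr P(1) pr[OF P(2)]] by simp
      moreover have "(\<integral>x. g x * cnj (h x) \<partial>M) = L (proj (u n)) + (\<integral>x. (g x - u n x) * cnj (h x) \<partial>M)"
        using integrable_Holder_cnj[OF gr _ r1 rs, of h] integrable_Holder_cnj[OF pr[OF un] _ r1 rs, of h] hs
        unfolding uh[OF u, symmetric] by (simp add: left_diff_distrib)
      ultimately have "norm (L g - (\<integral>x. g x * cnj (h x) \<partial>M)) \<le> norm (L k) + norm (\<integral>x. (g x - u n x) * cnj (h x) \<partial>M)"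
        using norm_triangle_ineq4[of "L k" "\<integral>x. (g x - u n x) * cnj (h x) \<partial>M"] by simp
      also have "norm (\<integral>x. (g x - u n x) * cnj (h x) \<partial>M) \<le> e n * Lnorm M s h"
        unfolding e_def using norm_integral_Holder_cnj[OF dr _ r1 rs] hs by blast
      finally show ?thesis using Lk by (simp add: algebra_simps)
    qed
    have "(\<lambda>n. (B * D + Lnorm M s h) * e n) \<longlonglongrightarrow> 0" using tendsto_mult_right_zero[OF e] by simp
    then have "norm (L g - (\<integral>x. g x * cnj (h x) \<partial>M)) \<le> 0"
      by (rule tendsto_lowerbound) (use key in auto)
    then show "L g = (\<integral>x. g x * cnj (h x) \<partial>M)" by simp
  qed (use h hs in auto)
qed

end

section \<open>Bergman spaces\<close>

definition holomorphic_zero_ext :: "(complex ^ 'n::finite) set \<Rightarrow> (complex ^ 'n \<Rightarrow> complex) set" where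
  "holomorphic_zero_ext \<Omega> = {f. holomorphic_several_on f \<Omega> \<and> (\<forall>z. z \<notin> \<Omega> \<longrightarrow> f z = 0)}"

lemma holomorphic_several_on_add:
  assumes "holomorphic_several_on f \<Omega>" "holomorphic_several_on g \<Omega>"
  shows "holomorphic_several_on (\<lambda>z. f z + g z) \<Omega>"
  unfolding holomorphic_several_on_def
proof
  fix z assume z: "z \<in> \<Omega>"
  obtain D E where D: "(f has_derivative D) (at z)" "\<And>c v. D (c *s v) = c * D v"
    and E: "(g has_derivative E) (at z)" "\<And>c v. E (c *s v) = c * E v"
    using assms z unfolding holomorphic_several_on_def by metis
  show "\<exists>D. ((\<lambda>z. f z + g z) has_derivative D) (at z) \<and> (\<forall>c v. D (c *s v) = c * D v)"
    by (rule exI[of _ "\<lambda>v. D v + E v"])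
      (auto intro!: has_derivative_add D(1) E(1) simp: D(2) E(2) distrib_left)
qed

lemma holomorphic_several_on_cmult:
  assumes "holomorphic_several_on f \<Omega>"
  shows "holomorphic_several_on (\<lambda>z. c * f z) \<Omega>"
  unfolding holomorphic_several_on_def
proof
  fix z assume z: "z \<in> \<Omega>"
  obtain D where D: "(f has_derivative D) (at z)" "\<And>c v. D (c *s v) = c * D v"
    using assms z unfolding holomorphic_several_on_def by metis
  show "\<exists>D. ((\<lambda>z. c * f z) has_derivative D) (at z) \<and> (\<forall>c v. D (c *s v) = c * D v)"
    by (rule exI[of _ "\<lambda>v. c * D v"])
      (auto intro!: has_derivative_mult_right D(1) simp: D(2))
qed

lemma bergman_space_eq: "bergman_space \<Omega> r = holomorphic_zero_ext \<Omega> \<inter> Lspace (lebesgue_on \<Omega>) r"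
  by (auto simp: bergman_space_def holomorphic_zero_ext_def Lspace_def Lr_set_def)

lemma Lr_norm_eq: "Lr_norm \<Omega> r = Lnorm (lebesgue_on \<Omega>) r"
  by (simp add: fun_eq_iff Lr_norm_def Lnorm_def)

lemma bergman_dual_eq:
  "bergman_dual \<Omega> r = {L \<in> extensional (bergman_space \<Omega> r).
     bdd_functional (lebesgue_on \<Omega>) (holomorphic_zero_ext \<Omega>) r L}"
  by (simp add: bergman_dual_def bdd_functional_def bergman_space_eq[symmetric] Lr_norm_eq)

lemma bdd_functional_cong:
  assumes V_add: "\<And>f g. f \<in> V \<Longrightarrow> g \<in> V \<Longrightarrow> (\<lambda>x. f x + g x) \<in> V"
    and V_cmult: "\<And>c f. f \<in> V \<Longrightarrow> (\<lambda>x. c * f x) \<in> V"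
    and r: "0 < r" and eq: "\<And>f. f \<in> V \<inter> Lspace M r \<Longrightarrow> L f = L' f"
  shows "bdd_functional M V r L \<longleftrightarrow> bdd_functional M V r L'"
proof -
  have "(\<lambda>x. f x + g x) \<in> V \<inter> Lspace M r" "(\<lambda>x. c * f x) \<in> V \<inter> Lspace M r"
    if "f \<in> V \<inter> Lspace M r" "g \<in> V \<inter> Lspace M r" for f g c
    using that V_add V_cmult Lspace_add[OF _ _ r] Lspace_cmult by auto
  then show ?thesis unfolding bdd_functional_def by (simp add: eq)
qed

text \<open>
  The inclusion of the image in the dual always holds, by Hoelder's inequality, and the extensional
  convention makes a functional equal to \<open>bergman_Phi \<Omega> r g\<close> as soon as both agree on the Bergman space.
\<close>
lemma bergman_Phi_surj_iff:
  fixes \<Omega> :: "(complex ^ 'n::finite) set"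
  assumes r: "1 < r" and rs: "1/r + 1/s = 1"
  shows "bergman_Phi \<Omega> r ` bergman_space \<Omega> s = bergman_dual \<Omega> r \<longleftrightarrow>
     pairing_onto (lebesgue_on \<Omega>) (holomorphic_zero_ext \<Omega>) r s"
    (is "?lhs \<longleftrightarrow> ?rhs")
proof -
  let ?M = "lebesgue_on \<Omega>" and ?V = "holomorphic_zero_ext \<Omega>"
  have Va: "f \<in> ?V \<Longrightarrow> g \<in> ?V \<Longrightarrow> (\<lambda>x. f x + g x) \<in> ?V"
   and Vc: "f \<in> ?V \<Longrightarrow> (\<lambda>x. c * f x) \<in> ?V" for f g c
    by (auto simp: holomorphic_zero_ext_def holomorphic_several_on_add holomorphic_several_on_cmult)
  have cong: "bdd_functional ?M ?V r L \<longleftrightarrow> bdd_functional ?M ?V r L'"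
    if "\<And>f. f \<in> bergman_space \<Omega> r \<Longrightarrow> L f = L' f" for L L'
    using r that by (intro bdd_functional_cong Va Vc) (auto simp: bergman_space_eq)
  have sub: "bergman_Phi \<Omega> r ` bergman_space \<Omega> s \<subseteq> bergman_dual \<Omega> r"
  proof (rule image_subsetI)
    fix g assume "g \<in> bergman_space \<Omega> s"
    then have "g \<in> Lspace ?M s" by (simp add: bergman_space_eq)
    from bdd_functional_pairing[OF this r rs, of ?V]
    have "bdd_functional ?M ?V r (bergman_Phi \<Omega> r g)"
      by (subst cong) (auto simp: bergman_Phi_def)
    then show "bergman_Phi \<Omega> r g \<in> bergman_dual \<Omega> r"
      by (simp add: bergman_dual_eq bergman_Phi_def)
  qed
  show ?thesis
  proof
    assume lhs: ?lhs
    show ?rhs unfolding pairing_onto_def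
    proof (intro allI impI)
      fix L assume "bdd_functional ?M ?V r L"
      then have "bdd_functional ?M ?V r (restrict L (bergman_space \<Omega> r))"
        by (subst cong) auto
      then have "restrict L (bergman_space \<Omega> r) \<in> bergman_Phi \<Omega> r ` bergman_space \<Omega> s"
        unfolding lhs by (simp add: bergman_dual_eq)
      then obtain g where g: "g \<in> bergman_space \<Omega> s" "restrict L (bergman_space \<Omega> r) = bergman_Phi \<Omega> r g"
        by blast
      have "L f = (\<integral>x. f x * cnj (g x) \<partial>?M)" if "f \<in> bergman_space \<Omega> r" for f
        using fun_cong[OF g(2), of f] that by (simp add: bergman_Phi_def)
      then show "\<exists>g\<in>?V \<inter> Lspace ?M s. \<forall>f\<in>?V \<inter> Lspace ?M r. L f = (\<integral>x. f x * cnj (g x) \<partial>?M)"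
        using g(1) unfolding bergman_space_eq by blast
    qed
  next
    assume rhs: ?rhs
    have "bergman_dual \<Omega> r \<subseteq> bergman_Phi \<Omega> r ` bergman_space \<Omega> s"
    proof
      fix L assume L: "L \<in> bergman_dual \<Omega> r"
      then obtain g where g: "g \<in> bergman_space \<Omega> s"
          "\<And>f. f \<in> bergman_space \<Omega> r \<Longrightarrow> L f = (\<integral>x. f x * cnj (g x) \<partial>?M)"
        using rhs unfolding pairing_onto_def bergman_dual_eq bergman_space_eq by blast
      have "L \<in> extensional (bergman_space \<Omega> r)" using L by (simp add: bergman_dual_def)
      then have "L = bergman_Phi \<Omega> r g"
        by (rule extensionalityI) (auto simp: bergman_Phi_def g(2))
      then show "L \<in> bergman_Phi \<Omega> r ` bergman_space \<Omega> s" using g(1) by blast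
    qed
    with sub show ?lhs by (rule subset_antisym)
  qed
qed

theorem mainTheorem2:
  fixes \<Omega> :: "(complex ^ 'n::finite) set" and p q p' s' :: real
  assumes "open \<Omega>" and "connected \<Omega>" and "\<Omega> \<noteq> {}" and "bounded \<Omega>"
    and "1 < q" and "q < 2" and "2 < p" and "1 / p + 1 / q = 1"
    and "bergman_Phi \<Omega> p ` bergman_space \<Omega> q = bergman_dual \<Omega> p"
    and "bergman_Phi \<Omega> q ` bergman_space \<Omega> p = bergman_dual \<Omega> q"
    and "q \<le> p'" and "p' \<le> p" and "1 / p' + 1 / s' = 1"
  shows "bergman_Phi \<Omega> p' ` bergman_space \<Omega> s' = bergman_dual \<Omega> p'"
proof -
  have p: "1 < p" and p': "1 < p'" using assms by auto
  have qp: "1/q + 1/p = 1" using assms by simp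
  have onto: "pairing_onto (lebesgue_on \<Omega>) (holomorphic_zero_ext \<Omega>) p q"
      "pairing_onto (lebesgue_on \<Omega>) (holomorphic_zero_ext \<Omega>) q p"
    using bergman_Phi_surj_iff[of p q \<Omega>] bergman_Phi_surj_iff[of q p \<Omega>] assms p qp by auto
  have s': "s' = p' / (p' - 1)" using conjugate_exponent(1)[OF p' assms(13)] .
  \<comment> \<open>At the two ends the claim is one of the hypotheses; the interpolated bound needs strict inequalities.\<close>
  consider "p' = q" | "p' = p" | "q < p'" "p' < p" using assms by linarith
  then show ?thesis
  proof cases
    case 1
    then have "s' = p" using s' conjugate_exponent(1)[OF assms(5) qp] by simp
    then show ?thesis using 1 assms by simp
  next
    case 2
    then have "s' = q" using s' conjugate_exponent(1)[OF p assms(8)] by simp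
    then show ?thesis using 2 assms by simp
  next
    case 3
    have "\<Omega> \<in> lmeasurable" using assms by (intro bounded_set_imp_lmeasurable) auto
    then interpret finite_measure "lebesgue_on \<Omega>" by (rule finite_measure_lebesgue_on)
    interpret dual_exponents "lebesgue_on \<Omega>" "holomorphic_zero_ext \<Omega>" p q
    proof
      show "f \<in> holomorphic_zero_ext \<Omega> \<Longrightarrow> g \<in> holomorphic_zero_ext \<Omega> \<Longrightarrow> (\<lambda>x. f x + g x) \<in> holomorphic_zero_ext \<Omega>"
        "f \<in> holomorphic_zero_ext \<Omega> \<Longrightarrow> (\<lambda>x. c * f x) \<in> holomorphic_zero_ext \<Omega>" for f g c
        by (auto simp: holomorphic_zero_ext_def holomorphic_several_on_add holomorphic_several_on_cmult)
    qed (use assms qp onto in auto)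
    show ?thesis
      using pairing_onto_between[OF 3 assms(13)] bergman_Phi_surj_iff[OF p' assms(13), of \<Omega>] by simp
  qed
qed

end
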